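(* Let $M,N\ge0$ be integers, let $\phi\in\mathcal{D}_N^M$ with $\widehat\phi(0)\ne0$. If $$\phi(\cdot-b)\in\overline{\operatorname{span}\{\phi(p^{-1}x-a):\ a\in I_p\}}$$ (closure in $L^2(\mathbb{Q}_p)$) for all $b\in I_p$ with $|b|_p\le p^N$, then $\#L_\phi\le p^N$, where $L_\phi=\{l\in\{0,1,\dots,p^{M+N}-1\}:\ \widehat\phi(l/p^M)\ne0\}$.
   Context: $p$ is a prime, $\mathbb{Q}_p$ the field of $p$-adic numbers with norm $|\cdot|_p$. The fractional part of $x=p^{\gamma}\sum_{j\ge0}x_jp^j$ ($x_j\in\{0,\dots,p-1\}$, $x_0\ne0$) is $\{x\}_p=p^{\gamma}\sum_{j=0}^{-\gamma-1}x_jp^j$, $\{0\}_p=0$; $\chi_p(x)=e^{2\pi i\{x\}_p}$; $I_p=\{a\in\mathbb{Q}_p:\{a\}_p=a\}$; $B_\gamma(a)=\{x:|x-a|_p\le p^\gamma\}$. $dx$ is Haar measure with $B_0(0)$ of measure $1$; $\widehat f(\xi)=\int\chi_p(\xi x)f(x)\,dx$. A test function is a locally constant compactly supported complex function on $\mathbb{Q}_p$. $\mathcal{D}_N^M$ is the set of test functions $\phi$ that are $p^M$-periodic ($\phi(x+p^M)=\phi(x)$) and supported in $B_N(0)$; equivalently, locally constant $\phi$ with $\operatorname{supp}\phi\subset B_N(0)$, $\operatorname{supp}\widehat\phi\subset B_M(0)$. *)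

theory Defs
  imports Complex_Main "HOL-Library.Cardinality" "HOL-Computational_Algebra.Primes"
begin

text \<open>An element of Q_p is represented by its p-adic digit sequence
  x = sum_j x_j p^j (j ranging over the integers), with 0 <= x_j < p and
  x_j = 0 for all sufficiently negative j.  The prime p is CARD('p).\<close>

typedef ('p::finite) qp =
  "{d :: int \<Rightarrow> nat. (\<forall>j. d j < CARD('p)) \<and> (\<exists>m. \<forall>j<m. d j = 0)}"
  morphisms digit Abs_qp
  by (rule exI[of _ "\<lambda>_. 0"]) auto

text \<open>j-th p-adic digit of a number r in Z[1/p] (r given as a real).\<close>
definition digit_of :: "nat \<Rightarrow> real \<Rightarrow> int \<Rightarrow> nat" where
  "digit_of P r j = nat (\<lfloor>r / (real P powi j)\<rfloor> mod int P)"

text \<open>Embedding of Z[1/p] into Q_p (only applied to elements of Z[1/p]).\<close>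
definition qp_of_real :: "real \<Rightarrow> 'p::finite qp" where
  "qp_of_real r = Abs_qp (digit_of CARD('p) r)"

text \<open>qp_trunc x n = sum_{j<n} x_j p^j, the canonical representative of x mod p^n Z_p.\<close>
definition qp_trunc :: "'p::finite qp \<Rightarrow> int \<Rightarrow> real" where
  "qp_trunc x n = (\<Sum>j\<in>{j. j < n \<and> digit x j \<noteq> 0}. real (digit x j) * real CARD('p) powi j)"

definition qp_low :: "'p::finite qp \<Rightarrow> int" where
  "qp_low x = (SOME m. m \<le> 0 \<and> (\<forall>j<m. digit x j = 0))"

instantiation qp :: (finite) "{zero, plus, minus, uminus, times}"
begin
definition zero_qp_def: "0 = Abs_qp (\<lambda>_. 0)"
definition plus_qp_def: "x + y =
  Abs_qp (\<lambda>j. digit_of CARD('a) (qp_trunc x (j+1) + qp_trunc y (j+1)) j)"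
definition minus_qp_def: "x - y =
  Abs_qp (\<lambda>j. digit_of CARD('a) (qp_trunc x (j+1) - qp_trunc y (j+1)) j)"
definition uminus_qp_def: "- (x::'a qp) = 0 - x"
definition times_qp_def: "x * y =
  Abs_qp (\<lambda>j. let n = \<bar>j\<bar> + 1 - qp_low x - qp_low y
              in digit_of CARD('a) (qp_trunc x n * qp_trunc y n) j)"
instance ..
end

definition qp_val :: "'p::finite qp \<Rightarrow> int" where
  "qp_val x = (THE j. digit x j \<noteq> 0 \<and> (\<forall>i<j. digit x i = 0))"

definition qp_norm :: "'p::finite qp \<Rightarrow> real" where
  "qp_norm x = (if x = 0 then 0 else real CARD('p) powi (- qp_val x))"

definition qp_ball :: "int \<Rightarrow> 'p::finite qp \<Rightarrow> 'p qp set" where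
  "qp_ball \<gamma> a = {x. qp_norm (x - a) \<le> real CARD('p) powi \<gamma>}"

definition qp_frac :: "'p::finite qp \<Rightarrow> real" where
  "qp_frac x = qp_trunc x 0"

definition qp_chi :: "'p::finite qp \<Rightarrow> complex" where
  "qp_chi x = cis (2 * pi * qp_frac x)"

definition qp_I :: "'p::finite qp set" where
  "qp_I = {a. qp_of_real (qp_frac a) = a}"

definition locally_constant :: "('p::finite qp \<Rightarrow> complex) \<Rightarrow> bool" where
  "locally_constant f = (\<forall>x. \<exists>\<gamma>. \<forall>y\<in>qp_ball \<gamma> x. f y = f x)"

text \<open>Compact support: the support lies in a ball (closed balls are compact,
  compact sets are bounded).\<close>
definition compact_support :: "('p::finite qp \<Rightarrow> complex) \<Rightarrow> bool" where
  "compact_support f = (\<exists>K. \<forall>x. f x \<noteq> 0 \<longrightarrow> x \<in> qp_ball K 0)"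

definition test_function :: "('p::finite qp \<Rightarrow> complex) \<Rightarrow> bool" where
  "test_function f = (locally_constant f \<and> compact_support f)"

text \<open>Haar integral (B_0(0) of measure 1) of a test function: if f is supported
  in B_K(0) and constant on cosets of B_{-k}(0), then
  int f dx = p^{-k} * sum of f over representatives i/p^K, 0 <= i < p^(K+k),
  of the cosets of B_{-k}(0) in B_K(0); this holds for all large K, k.\<close>
definition qp_integral :: "('p::finite qp \<Rightarrow> complex) \<Rightarrow> complex" where
  "qp_integral f = (THE I. \<exists>K0::nat. \<forall>K\<ge>K0. \<forall>k\<ge>K0.
      I = complex_of_real (real CARD('p) powi (- int k)) *
          (\<Sum>i<CARD('p) ^ (K + k). f (qp_of_real (real i / real CARD('p) ^ K))))"

definition qp_fourier :: "('p::finite qp \<Rightarrow> complex) \<Rightarrow> 'p qp \<Rightarrow> complex" where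
  "qp_fourier f \<xi> = qp_integral (\<lambda>x. qp_chi (\<xi> * x) * f x)"

definition D_space :: "nat \<Rightarrow> nat \<Rightarrow> ('p::finite qp \<Rightarrow> complex) set" where
  "D_space N M = {\<phi>. test_function \<phi>
      \<and> (\<forall>x. \<phi> (x + qp_of_real (real CARD('p) ^ M)) = \<phi> x)
      \<and> (\<forall>x. \<phi> x \<noteq> 0 \<longrightarrow> x \<in> qp_ball (int N) 0)}"

definition cspan :: "('p::finite qp \<Rightarrow> complex) set \<Rightarrow> ('p qp \<Rightarrow> complex) set" where
  "cspan S = {h. \<exists>(n::nat) c g. (\<forall>i<n. g i \<in> S) \<and> h = (\<lambda>x. \<Sum>i<n. c i * g i x)}"

definition L2_dist2 :: "('p::finite qp \<Rightarrow> complex) \<Rightarrow> ('p qp \<Rightarrow> complex) \<Rightarrow> real" where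
  "L2_dist2 f g = Re (qp_integral (\<lambda>x. complex_of_real ((cmod (f x - g x))\<^sup>2)))"

text \<open>g lies in the L^2 closure of the span of S (S, g consisting of test functions,
  so the span consists of test functions as well).\<close>
definition in_L2_closure_span :: "('p::finite qp \<Rightarrow> complex) \<Rightarrow> ('p qp \<Rightarrow> complex) set \<Rightarrow> bool" where
  "in_L2_closure_span g S = (\<forall>\<epsilon>>0. \<exists>h\<in>cspan S. L2_dist2 g h < \<epsilon>)"

end

theory Submission
  imports Defs
begin

text \<open>Restricted to the points of Z[1/p], \<phi> becomes a function g on the cyclic group of
  order n = p^(M+N), where i stands for i/p^N, and the values of the Fourier transform at l/p^M are
  the discrete Fourier transform of g.  Modulo p^(M+1) and on the ball of radius p^N the
  generators \<phi>(x/p - a) span a finite-dimensional, hence closed, space, so each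
  translate g(i - b), b < q = p^N, is a combination of the translates by k < pq of the
  upsampled g.  On the Fourier side of order np this reads, with z = z_l the l-th root of unity,
    [p | l] p z^b ghat(l/p) = m_b(z) ghat(l)
  for polynomials m_b of degree less than pq.  Thus L is mapped into itself by l |-> pl, and
  of the p #L residues l mod np with ghat(l) nonzero all but the #L residues pl' with l' in L
  are common roots of the m_b.  If #L > q, then the m_b are linearly independent
  (a combination of the z^b vanishing on L is zero), while the polynomials of degree less
  than pq with these (p - 1) #L roots form a space of dimension at most pq - (p - 1) #L < q.\<close>

subsection \<open>Arithmetic of Z[1/p] inside Q_p\<close>

text \<open>The subring Z[1/P] of the reals.\<close>

definition Z_inv :: "nat \<Rightarrow> real set" where
  "Z_inv P = {r. \<exists>k::nat. r * real P ^ k \<in> \<int>}"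

lemma Z_inv_mono:
  assumes "r * real P ^ k \<in> \<int>" "k \<le> m"
  shows "r * real P ^ m \<in> \<int>"
proof -
  have "r * real P ^ m = (r * real P ^ k) * real P ^ (m - k)"
    using assms(2) by (simp add: power_add[symmetric] mult.assoc)
  moreover have "(r * real P ^ k) * real P ^ (m - k) \<in> \<int>"
    by (rule Ints_mult[OF assms(1) Ints_power[OF Ints_of_nat]])
  ultimately show ?thesis by (simp only:)
qed

lemma Z_inv_common:
  assumes "r \<in> Z_inv P" "s \<in> Z_inv P"
  obtains k where "r * real P ^ k \<in> \<int>" "s * real P ^ k \<in> \<int>"
proof -
  obtain a b where a: "r * real P ^ a \<in> \<int>" and b: "s * real P ^ b \<in> \<int>"
    using assms by (auto simp: Z_inv_def)
  show thesis
    using that[of "max a b"] Z_inv_mono[OF a] Z_inv_mono[OF b] by simp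
qed

lemma Z_inv_add: "r \<in> Z_inv P \<Longrightarrow> s \<in> Z_inv P \<Longrightarrow> r + s \<in> Z_inv P"
  by (erule (1) Z_inv_common) (unfold Z_inv_def mem_Collect_eq, metis Ints_add distrib_right)

lemma Z_inv_diff: "r \<in> Z_inv P \<Longrightarrow> s \<in> Z_inv P \<Longrightarrow> r - s \<in> Z_inv P"
  by (erule (1) Z_inv_common) (unfold Z_inv_def mem_Collect_eq, metis Ints_diff left_diff_distrib)

lemma Z_inv_mult:
  assumes "r \<in> Z_inv P" "s \<in> Z_inv P"
  shows "r * s \<in> Z_inv P"
proof -
  obtain a b where a: "r * real P ^ a \<in> \<int>" and b: "s * real P ^ b \<in> \<int>"
    using assms by (auto simp: Z_inv_def)
  have "r * s * real P ^ (a + b) = (r * real P ^ a) * (s * real P ^ b)"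
    by (simp add: power_add)
  then have "r * s * real P ^ (a + b) \<in> \<int>" using Ints_mult[OF a b] by (simp only:)
  then show ?thesis unfolding Z_inv_def by blast
qed

lemma Z_inv_Ints: "r \<in> \<int> \<Longrightarrow> r \<in> Z_inv P"
  by (auto simp: Z_inv_def intro!: exI[of _ 0])

lemma Z_inv_div_power:
  assumes "P > 0" "r \<in> \<int>"
  shows "r / real P ^ k \<in> Z_inv P"
  using assms by (auto simp: Z_inv_def intro!: exI[of _ k])

lemma Z_inv_sum: "(\<And>x. x \<in> A \<Longrightarrow> f x \<in> Z_inv P) \<Longrightarrow> sum f A \<in> Z_inv P"
  by (induction A rule: infinite_finite_induct) (auto intro: Z_inv_add Z_inv_Ints)

lemma Z_inv_powi:
  assumes "P > 0"
  shows "real P powi j \<in> Z_inv P"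
  using assms by (cases "j \<ge> 0")
    (auto simp: power_int_def Z_inv_Ints intro!: Z_inv_div_power[of P 1 , simplified] simp: field_simps)

lemma div_powi_in_Ints_mono:
  assumes "P > 0" "r / real P powi m \<in> \<int>" "j \<le> m"
  shows "r / real P powi j \<in> \<int>"
proof -
  have "real P powi m = real P powi (j + int (nat (m - j)))"
    using assms by simp
  also have "\<dots> = real P powi j * real P ^ nat (m - j)"
    by (subst power_int_add) (use assms in \<open>simp_all only: power_int_of_nat, simp\<close>)
  finally have "real P powi m = real P powi j * real P ^ nat (m - j)" .
  hence "r / real P powi j = (r / real P powi m) * real P ^ nat (m - j)"
    using assms(1) by simp
  also have "\<dots> \<in> \<int>"
    by (rule Ints_mult[OF assms(2) Ints_power[OF Ints_of_nat]])
  finally show ?thesis .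
qed

lemma Z_inv_powi_div:
  assumes "P > 0" "r \<in> Z_inv P"
  obtains m where "r / real P powi m \<in> \<int>"
proof -
  obtain k where "r * real P ^ k \<in> \<int>" using assms by (auto simp: Z_inv_def)
  then show thesis using that[of "- int k"] assms(1) by (simp add: power_int_minus field_simps)
qed

section \<open>Digits and truncations of elements of Z[1/p]\<close>

lemma digit_of_less: "P > 0 \<Longrightarrow> digit_of P r j < P"
  unfolding digit_of_def by (metis nat_less_iff of_nat_0_less_iff pos_mod_bound pos_mod_sign)

text \<open>Integer division of the floor at level j by P gives the floor at level j + 1. Each digit
  term is thus a difference of consecutive values of one function of j, and sums of digits
  telescope.\<close>

lemma digit_of_mult_powi:
  assumes "P > 0"
  shows "real (digit_of P r j) * real P powi j =
    real P powi j * of_int \<lfloor>r / real P powi j\<rfloor>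
      - real P powi (j + 1) * of_int \<lfloor>r / real P powi (j + 1)\<rfloor>"
proof -
  let ?x = "r / real P powi j"
  have s: "real P powi (j + 1) = real P powi j * real P"
    using assms by (simp add: power_int_add)
  have f: "\<lfloor>r / real P powi (j + 1)\<rfloor> = \<lfloor>?x\<rfloor> div int P"
    unfolding s using floor_divide_real_eq_div[of "int P" ?x] assms by (simp add: field_simps)
  have "real (digit_of P r j) = of_int (\<lfloor>?x\<rfloor> mod int P)"
    using assms by (simp add: digit_of_def)
  also have "\<dots> = of_int \<lfloor>?x\<rfloor> - real P * of_int (\<lfloor>?x\<rfloor> div int P)"
    by (metis minus_mult_div_eq_mod of_int_diff of_int_mult of_int_of_nat_eq)
  finally have "real (digit_of P r j) = \<dots>" .
  then show ?thesis unfolding f by (simp only: left_diff_distrib right_diff_distrib s mult_ac)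
qed

lemma digit_of_eq_0:
  assumes "P > 0" "r / real P powi m \<in> \<int>" "j < m"
  shows "digit_of P r j = 0"
proof -
  have "r / real P powi j \<in> \<int>" "r / real P powi (j + 1) \<in> \<int>"
    using div_powi_in_Ints_mono[OF assms(1,2)] assms(3) by auto
  then have "real (digit_of P r j) * real P powi j = 0"
    unfolding digit_of_mult_powi[OF assms(1)]
    using assms(1) by (simp add: of_int_floor)
  then show ?thesis using assms(1) by simp
qed

text \<open>A multiple of P^(j+1) moves the floor at level j by a multiple of P. The ring operations
  are computed from truncations, and this lemma absorbs the truncation errors.\<close>

lemma digit_of_cong:
  assumes "P > 0" "(r - s) / real P powi (j + 1) \<in> \<int>"
  shows "digit_of P r j = digit_of P s j"
proof -
  obtain u where u: "(r - s) / real P powi (j + 1) = of_int u"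
    using assms(2) Ints_cases by blast
  have "r / real P powi j = s / real P powi j + of_int (u * int P)"
    using u assms(1) by (simp add: power_int_add field_simps)
  then have "\<lfloor>r / real P powi j\<rfloor> = \<lfloor>s / real P powi j\<rfloor> + u * int P"
    by (metis floor_add_int)
  then show ?thesis by (simp add: digit_of_def)
qed

text \<open>Membership in Z[1/p] makes the digits vanish far to the left, so the digit sequence lies
  in the represented set and \<open>Abs_qp\<close> can be inverted.\<close>

lemma digit_qp_of_real:
  assumes "r \<in> Z_inv CARD('p::finite)"
  shows "digit (qp_of_real r :: 'p qp) = digit_of CARD('p) r"
proof -
  obtain m where "r / real CARD('p) powi m \<in> \<int>"
    using Z_inv_powi_div[OF _ assms] by auto
  then have "\<forall>j<m. digit_of CARD('p) r j = 0"
    using digit_of_eq_0 by auto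
  then show ?thesis
    unfolding qp_of_real_def by (subst Abs_qp_inverse) (auto simp: digit_of_less)
qed

lemma atLeastLessThan_add1_int:
  fixes m :: int
  shows "m \<le> i \<Longrightarrow> {m..<i + 1} = insert i {m..<i}"
  by auto

lemma qp_trunc_qp_of_real:
  assumes "r \<in> Z_inv CARD('p::finite)"
  shows "qp_trunc (qp_of_real r :: 'p qp) n =
    r - real CARD('p) powi n * of_int \<lfloor>r / real CARD('p) powi n\<rfloor>"
proof -
  let ?P = "CARD('p)"
  obtain m0 where m0: "r / real ?P powi m0 \<in> \<int>"
    using Z_inv_powi_div[OF _ assms] by auto
  \<comment> \<open>Starting the telescoping sum at a level where r / P^m is an integer makes its
    first term r itself.\<close>
  define m where "m = min m0 n"
  have m: "r / real ?P powi m \<in> \<int>" "m \<le> n"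
    using div_powi_in_Ints_mono[OF _ m0, of m] by (auto simp: m_def)
  define F where "F j = real ?P powi j * of_int \<lfloor>r / real ?P powi j\<rfloor>" for j
  have "qp_trunc (qp_of_real r :: 'p qp) n
      = (\<Sum>j\<in>{m..<n}. real (digit_of ?P r j) * real ?P powi j)"
    unfolding qp_trunc_def digit_qp_of_real[OF assms]
  proof (rule sum.mono_neutral_left)
    show "{j. j < n \<and> digit_of CARD('p) r j \<noteq> 0} \<subseteq> {m..<n}"
      using digit_of_eq_0[OF _ m(1)] by (force simp: not_less[symmetric])
  qed auto
  also have "\<dots> = (\<Sum>j\<in>{m..<n}. F j - F (j + 1))"
    unfolding F_def by (intro sum.cong refl digit_of_mult_powi) auto
  also have "\<dots> = F m - F n"
    using m(2) by (induction n rule: int_ge_induct)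
      (auto simp: atLeastLessThan_add1_int)
  also have "F m = r"
    using m(1) by (simp add: F_def of_int_floor)
  finally show ?thesis by (simp add: F_def)
qed


section \<open>Ring operations on the image of Z[1/p]\<close>

lemma qp_trunc_cong:
  assumes "r \<in> Z_inv CARD('p::finite)"
  obtains u where "qp_trunc (qp_of_real r :: 'p qp) n = r - real CARD('p) powi n * of_int u"
  using qp_trunc_qp_of_real[OF assms] by blast

lemma qp_of_real_add:
  assumes "r \<in> Z_inv CARD('p::finite)" "s \<in> Z_inv CARD('p)"
  shows "(qp_of_real r :: 'p qp) + qp_of_real s = qp_of_real (r + s)"
proof -
  have "digit_of CARD('p) (qp_trunc (qp_of_real r :: 'p qp) (j+1) + qp_trunc (qp_of_real s :: 'p qp) (j+1)) j
      = digit_of CARD('p) (r + s) j" for j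
  proof (rule digit_of_cong)
    show "(qp_trunc (qp_of_real r :: 'p qp) (j+1) + qp_trunc (qp_of_real s :: 'p qp) (j+1) - (r + s))
        / real CARD('p) powi (j + 1) \<in> \<int>"
      unfolding qp_trunc_qp_of_real[OF assms(1)] qp_trunc_qp_of_real[OF assms(2)]
      by (simp add: diff_divide_distrib add_divide_distrib)
  qed auto
  then show ?thesis unfolding plus_qp_def by (simp add: qp_of_real_def)
qed

lemma qp_of_real_diff:
  assumes "r \<in> Z_inv CARD('p::finite)" "s \<in> Z_inv CARD('p)"
  shows "(qp_of_real r :: 'p qp) - qp_of_real s = qp_of_real (r - s)"
proof -
  have "digit_of CARD('p) (qp_trunc (qp_of_real r :: 'p qp) (j+1) - qp_trunc (qp_of_real s :: 'p qp) (j+1)) j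
      = digit_of CARD('p) (r - s) j" for j
  proof (rule digit_of_cong)
    show "(qp_trunc (qp_of_real r :: 'p qp) (j+1) - qp_trunc (qp_of_real s :: 'p qp) (j+1) - (r - s))
        / real CARD('p) powi (j + 1) \<in> \<int>"
      unfolding qp_trunc_qp_of_real[OF assms(1)] qp_trunc_qp_of_real[OF assms(2)]
      by (simp add: diff_divide_distrib add_divide_distrib)
  qed auto
  then show ?thesis unfolding minus_qp_def by (simp add: qp_of_real_def)
qed

lemma qp_trunc_eq_0_iff:
  assumes "r \<in> Z_inv CARD('p::finite)"
  shows "(\<forall>j<n. digit (qp_of_real r :: 'p qp) j = 0) \<longleftrightarrow> r / real CARD('p) powi n \<in> \<int>"
proof
  assume "\<forall>j<n. digit (qp_of_real r :: 'p qp) j = 0"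
  then have "{j. j < n \<and> digit (qp_of_real r :: 'p qp) j \<noteq> 0} = {}" by auto
  then have "qp_trunc (qp_of_real r :: 'p qp) n = 0"
    unfolding qp_trunc_def by simp
  then obtain u where "r = real CARD('p) powi n * of_int u"
    using qp_trunc_cong[OF assms, of n] by auto
  then show "r / real CARD('p) powi n \<in> \<int>" by simp
next
  assume "r / real CARD('p) powi n \<in> \<int>"
  then show "\<forall>j<n. digit (qp_of_real r :: 'p qp) j = 0"
    using digit_of_eq_0[of "CARD('p)" r n] by (simp add: digit_qp_of_real[OF assms])
qed

lemma qp_low_qp_of_real:
  assumes "r \<in> Z_inv CARD('p::finite)"
  shows "qp_low (qp_of_real r :: 'p qp) \<le> 0"
    and "r / real CARD('p) powi qp_low (qp_of_real r :: 'p qp) \<in> \<int>"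
proof -
  obtain m where m: "r / real CARD('p) powi m \<in> \<int>"
    using Z_inv_powi_div[OF _ assms] by auto
  then have "r / real CARD('p) powi (min m 0) \<in> \<int>"
    using div_powi_in_Ints_mono[OF _ m, of "min m 0"] by auto
  then have "min m 0 \<le> 0 \<and> (\<forall>j<min m 0. digit (qp_of_real r :: 'p qp) j = 0)"
    using qp_trunc_eq_0_iff[OF assms] by (metis min.cobounded2)
  then have "qp_low (qp_of_real r :: 'p qp) \<le> 0 \<and>
      (\<forall>j<qp_low (qp_of_real r :: 'p qp). digit (qp_of_real r :: 'p qp) j = 0)"
    unfolding qp_low_def by (rule someI)
  then show "qp_low (qp_of_real r :: 'p qp) \<le> 0"
    and "r / real CARD('p) powi qp_low (qp_of_real r :: 'p qp) \<in> \<int>"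
    using qp_trunc_eq_0_iff[OF assms] by blast+
qed

lemma qp_of_real_mult:
  assumes r: "r \<in> Z_inv CARD('p::finite)" and s: "s \<in> Z_inv CARD('p)"
  shows "(qp_of_real r :: 'p qp) * qp_of_real s = qp_of_real (r * s)"
proof -
  let ?r = "qp_of_real r :: 'p qp" and ?s = "qp_of_real s :: 'p qp"
  let ?p = "real CARD('p)"
  have "digit_of CARD('p) (qp_trunc ?r n * qp_trunc ?s n) j = digit_of CARD('p) (r * s) j"
    if n: "n = \<bar>j\<bar> + 1 - qp_low ?r - qp_low ?s" for n j
  proof (rule digit_of_cong)
    obtain u where u: "qp_trunc ?r n = r - ?p powi n * of_int u"
      by (rule qp_trunc_cong[OF r])
    obtain v where v: "qp_trunc ?s n = s - ?p powi n * of_int v"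
      by (rule qp_trunc_cong[OF s])
    have low: "qp_low ?r \<le> 0" "qp_low ?s \<le> 0"
      using qp_low_qp_of_real(1) r s by blast+
    \<comment> \<open>Replacing r and s by their truncations costs multiples of r p^n, s p^n and
      p^(2n). The precision n exceeds j by enough to offset the possibly negative valuations of r
      and s, so all three are divisible by p^(j+1).\<close>
    have *: "x * ?p powi n / ?p powi (j + 1) \<in> \<int>" if x: "x / ?p powi m \<in> \<int>" and "m + n \<ge> j + 1" for x m
    proof -
      have "x / ?p powi (j + 1 - n) \<in> \<int>"
        by (rule div_powi_in_Ints_mono[OF _ x]) (use that in auto)
      moreover have "?p powi (j + 1 - n) = ?p powi (j + 1) / ?p powi n"
        by (rule power_int_diff) auto
      ultimately show ?thesis by simp
    qed
    have 1: "r * ?p powi n / ?p powi (j + 1) \<in> \<int>"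
      by (rule *[OF qp_low_qp_of_real(2)[OF r]]) (use n low in linarith)
    have 2: "s * ?p powi n / ?p powi (j + 1) \<in> \<int>"
      by (rule *[OF qp_low_qp_of_real(2)[OF s]]) (use n low in linarith)
    have 3: "?p powi n * ?p powi n / ?p powi (j + 1) \<in> \<int>"
      by (rule *[of _ 0]) (use n low in \<open>auto simp: power_int_def\<close>)
    have "(qp_trunc ?r n * qp_trunc ?s n - r * s) / ?p powi (j + 1)
      = of_int u * of_int v * (?p powi n * ?p powi n / ?p powi (j + 1))
        - of_int v * (r * ?p powi n / ?p powi (j + 1))
        - of_int u * (s * ?p powi n / ?p powi (j + 1))"
      unfolding u v by (simp add: field_simps)
    also have "\<dots> \<in> \<int>"
      by (intro Ints_diff Ints_mult 1 2 3 Ints_of_int)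
    finally show "(qp_trunc ?r n * qp_trunc ?s n - r * s) / ?p powi (j + 1) \<in> \<int>" .
  qed auto
  then show ?thesis unfolding times_qp_def by (simp add: qp_of_real_def Let_def)
qed

section \<open>Norm, additive character and the set I_p on Z[1/p]\<close>

lemma qp_of_real_0: "(qp_of_real 0 :: 'p::finite qp) = 0"
proof -
  have "digit_of CARD('p) 0 = (\<lambda>_. 0)" by (simp add: fun_eq_iff digit_of_def)
  then show ?thesis by (simp add: qp_of_real_def zero_qp_def)
qed

lemma qp_norm_qp_of_real_le_iff:
  assumes r: "r \<in> Z_inv CARD('p::finite)" and "CARD('p) > 1"
  shows "qp_norm (qp_of_real r :: 'p qp) \<le> real CARD('p) ^ N \<longleftrightarrow> r * real CARD('p) ^ N \<in> \<int>"
proof -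
  let ?x = "qp_of_real r :: 'p qp"
  have eq: "r * real CARD('p) ^ N \<in> \<int> \<longleftrightarrow> (\<forall>j < - int N. digit ?x j = 0)"
    unfolding qp_trunc_eq_0_iff[OF r] by (simp add: power_int_minus field_simps)
  show ?thesis
  proof (cases "\<forall>j. digit ?x j = 0")
    case True
    then have "digit ?x = (\<lambda>_. 0)" by auto
    then have "?x = 0"
      unfolding zero_qp_def by (metis digit_inverse)
    then show ?thesis using True eq by (simp add: qp_norm_def)
  next
    case False
    then obtain j0 where j0: "digit ?x j0 \<noteq> 0" by blast
    obtain m where m: "\<forall>j<m. digit ?x j = 0" using digit[of ?x] by auto
    \<comment> \<open>All digits below m vanish, so the lowest nonzero digit is found by a search
      upwards from m over natural offsets.\<close>
    define v where "v = m + int (LEAST k. digit ?x (m + int k) \<noteq> 0)"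
    have "digit ?x (m + int (nat (j0 - m))) \<noteq> 0"
      using j0 m by (metis add.commute diff_add_cancel int_nat_eq linorder_not_less diff_ge_0_iff_ge)
    then have v1: "digit ?x v \<noteq> 0" unfolding v_def by (rule LeastI)
    have v2: "digit ?x i = 0" if "i < v" for i
    proof (cases "i < m")
      case False
      then have "i = m + int (nat (i - m))" by simp
      then show ?thesis using not_less_Least[of "nat (i - m)" "\<lambda>k. digit ?x (m + int k) \<noteq> 0"] that
        unfolding v_def by fastforce
    qed (use m in auto)
    have "qp_val ?x = v"
      unfolding qp_val_def
    proof (rule the_equality)
      fix j assume "digit ?x j \<noteq> 0 \<and> (\<forall>i<j. digit ?x i = 0)"
      then show "j = v" using v1 v2 linorder_neqE[of j v] by metis
    qed (use v1 v2 in auto)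
    moreover have "?x \<noteq> 0"
    proof
      assume "?x = 0"
      then have "digit ?x v = digit (qp_of_real 0 :: 'p qp) v" by (simp add: qp_of_real_0)
      then show False using v1 by (subst (asm) digit_qp_of_real) (auto simp: Z_inv_Ints digit_of_def digit_qp_of_real)
    qed
    ultimately have "qp_norm ?x \<le> real CARD('p) ^ N \<longleftrightarrow> real CARD('p) powi (- v) \<le> real CARD('p) powi int N"
      by (simp add: qp_norm_def)
    also have "\<dots> \<longleftrightarrow> - v \<le> int N"
      using power_int_increasing[of "- v" "int N" "real CARD('p)"]
        power_int_strict_increasing[of "int N" "- v" "real CARD('p)"] assms(2)
      by (cases "- v \<le> int N") (simp_all add: not_le)
    also have "\<dots> \<longleftrightarrow> (\<forall>j < - int N. digit ?x j = 0)"
      using v1 v2 by (metis (no_types, opaque_lifting) minus_le_iff not_less order_less_le_trans)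
    finally show ?thesis using eq by simp
  qed
qed

lemma qp_frac_qp_of_real:
  assumes "r \<in> Z_inv CARD('p::finite)"
  shows "qp_frac (qp_of_real r :: 'p qp) = frac r"
  unfolding qp_frac_def qp_trunc_qp_of_real[OF assms] by (simp add: frac_def)

text \<open>The integer part of r contributes a factor 1, so no fractional part is left in the
  formula; this is how the p-adic Fourier transform becomes a discrete one.\<close>

lemma qp_chi_qp_of_real:
  assumes "r \<in> Z_inv CARD('p::finite)"
  shows "qp_chi (qp_of_real r :: 'p qp) = cis (2 * pi * r)"
proof -
  have "cis (2 * pi * r) = cis (2 * pi * frac r) * cis (2 * pi * of_int \<lfloor>r\<rfloor>)"
    by (simp add: cis_mult frac_def algebra_simps)
  also have "cis (2 * pi * of_int \<lfloor>r\<rfloor>) = 1"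
    by (rule cis_multiple_2pi) auto
  finally show ?thesis by (simp add: qp_chi_def qp_frac_qp_of_real[OF assms])
qed

lemma qp_frac_Z_inv: "qp_frac (x :: 'p::finite qp) \<in> Z_inv CARD('p)"
  unfolding qp_frac_def qp_trunc_def
  by (intro Z_inv_sum Z_inv_mult Z_inv_powi) (auto intro: Z_inv_Ints)

lemma qp_I_cases:
  assumes "a \<in> (qp_I :: 'p::finite qp set)"
  obtains r where "r \<in> Z_inv CARD('p)" "0 \<le> r" "r < 1" "a = qp_of_real r"
proof (rule that[of "qp_frac a"])
  show "qp_frac a \<in> Z_inv CARD('p)" by (rule qp_frac_Z_inv)
  show a: "a = qp_of_real (qp_frac a)" using assms by (simp add: qp_I_def)
  have "qp_frac a = frac (qp_frac a)"
    by (subst a) (rule qp_frac_qp_of_real[OF qp_frac_Z_inv])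
  then show "0 \<le> qp_frac a" "qp_frac a < 1"
    using frac_ge_0 frac_lt_1 by metis+
qed

lemma qp_of_real_in_qp_I:
  assumes "r \<in> Z_inv CARD('p)" "0 \<le> r" "r < 1"
  shows "qp_of_real r \<in> (qp_I :: 'p::finite qp set)"
  unfolding qp_I_def mem_Collect_eq qp_frac_qp_of_real[OF assms(1)]
  using assms(2,3) by (simp add: frac_eq)

subsection \<open>Finite-dimensional linear algebra\<close>

text \<open>A nonzero polynomial of degree less than d has fewer than d roots. This serves both to
  kill a combination of the \<open>m b\<close> and to show that its coefficients are zero.\<close>

lemma coeffs_eq_0_if_many_roots:
  fixes c :: "nat \<Rightarrow> complex"
  assumes "finite Z" "d \<le> card Z" "\<And>z. z \<in> Z \<Longrightarrow> (\<Sum>i<d. c i * z ^ i) = 0" "k < d"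
  shows "c k = 0"
proof (rule ccontr)
  assume "c k \<noteq> 0"
  moreover have d: "{..<d} = {..d - 1}" using assms(4) by auto
  ultimately have fin: "finite {z. (\<Sum>i<d. c i * z ^ i) = 0}"
    and card: "card {z. (\<Sum>i<d. c i * z ^ i) = 0} \<le> d - 1"
    using polyfun_rootbound[of c k "d - 1"] assms(4) by (auto simp: d)
  have "card Z \<le> card {z. (\<Sum>i<d. c i * z ^ i) = 0}"
    by (rule card_mono[OF fin]) (use assms(3) in auto)
  then show False using card assms(2,4) by linarith
qed

text \<open>Gaussian elimination, by induction on the equations: if equation e involves the unknown
  \<open>c b0\<close>, it is solved for that unknown and the result is substituted into the
  others.\<close>

lemma nontrivial_solution:
  fixes A :: "'b \<Rightarrow> 'e \<Rightarrow> 'f::field"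
  assumes "finite E" "finite B" "card E < card B"
  shows "\<exists>c. (\<exists>b\<in>B. c b \<noteq> 0) \<and> (\<forall>e\<in>E. (\<Sum>b\<in>B. c b * A b e) = 0)"
  using assms
proof (induction E arbitrary: A B rule: finite_induct)
  case empty
  then have "B \<noteq> {}" by auto
  then show ?case by (intro exI[of _ "\<lambda>_. 1"]) auto
next
  case (insert e E)
  show ?case
  proof (cases "\<forall>b\<in>B. A b e = 0")
    case True
    have "card E < card B" using insert by simp
    from insert.IH[OF insert.prems(1) this] show ?thesis using True by simp
  next
    case False
    then obtain b0 where b0: "b0 \<in> B" "A b0 e \<noteq> 0" by blast
    define B' where "B' = B - {b0}"
    have B: "B = insert b0 B'" "b0 \<notin> B'" "finite B'"
      using b0 insert.prems by (auto simp: B'_def)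
    have "card E < card B'" using insert B by simp
    from insert.IH[OF B(3) this, of "\<lambda>b x. A b x - A b e / A b0 e * A b0 x"]
    obtain c where c: "\<exists>b\<in>B'. c b \<noteq> 0"
      "\<And>x. x \<in> E \<Longrightarrow> (\<Sum>b\<in>B'. c b * (A b x - A b e / A b0 e * A b0 x)) = 0"
      by blast
    \<comment> \<open>The value at \<open>b0\<close> is the one that equation e forces.\<close>
    define c' where "c' = c(b0 := - (\<Sum>b\<in>B'. c b * (A b e / A b0 e)))"
    have c': "(\<Sum>b\<in>B. c' b * A b x) = (\<Sum>b\<in>B'. c b * (A b x - A b e / A b0 e * A b0 x))" for x
    proof -
      have "(\<Sum>b\<in>B'. c' b * A b x) = (\<Sum>b\<in>B'. c b * A b x)"
        by (rule sum.cong) (use B in \<open>auto simp: c'_def\<close>)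
      then have "(\<Sum>b\<in>B. c' b * A b x) = c' b0 * A b0 x + (\<Sum>b\<in>B'. c b * A b x)"
        unfolding B(1) using B by simp
      then show ?thesis
        by (simp add: c'_def right_diff_distrib sum_subtractf sum_distrib_right mult.assoc)
    qed
    show ?thesis
    proof (intro exI[of _ c'] conjI ballI)
      show "\<exists>b\<in>B. c' b \<noteq> 0" using c(1) B by (auto simp: c'_def)
      show "(\<Sum>b\<in>B. c' b * A b x) = 0" if "x \<in> insert e E" for x
        using that c(2) b0 unfolding c' by auto
    qed
  qed
qed

text \<open>Induction on the number of spanning vectors. If \<open>w n\<close> depends on the
  earlier ones, the alternative for f carries over. Otherwise some functional u kills the earlier
  vectors but not \<open>w n\<close>, and the alternative is applied to f minus a multiple of
  \<open>w n\<close>.\<close>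

lemma span_or_separating_functional:
  fixes f :: "'x \<Rightarrow> 'f::field" and w :: "nat \<Rightarrow> 'x \<Rightarrow> 'f"
  assumes "finite X"
  shows "(\<exists>c. \<forall>x\<in>X. f x = (\<Sum>j<n. c j * w j x)) \<or>
    (\<exists>u. (\<forall>j<n. (\<Sum>x\<in>X. u x * w j x) = 0) \<and> (\<Sum>x\<in>X. u x * f x) \<noteq> 0)"
proof (induction n arbitrary: f)
  case 0
  show ?case
  proof (cases "\<forall>x\<in>X. f x = 0")
    case False
    then obtain a where a: "a \<in> X" "f a \<noteq> 0" by blast
    have "(\<Sum>x\<in>X. (if x = a then 1 else 0) * f x) = (\<Sum>x\<in>X. if x = a then f x else 0)"
      by (rule sum.cong) auto
    also have "\<dots> = f a" using a assms by simp
    finally show ?thesis using a by (intro disjI2 exI[of _ "\<lambda>x. if x = a then 1 else 0"]) auto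
  qed auto
next
  case (Suc n)
  from Suc.IH[of "w n"] show ?case
  proof
    assume "\<exists>c. \<forall>x\<in>X. w n x = (\<Sum>j<n. c j * w j x)"
    then obtain c where c: "\<And>x. x \<in> X \<Longrightarrow> w n x = (\<Sum>j<n. c j * w j x)" by blast
    from Suc.IH[of f] show ?thesis
    proof (elim disjE exE conjE)
      fix d assume "\<forall>x\<in>X. f x = (\<Sum>j<n. d j * w j x)"
      then have "\<forall>x\<in>X. f x = (\<Sum>j<Suc n. (d(n := 0)) j * w j x)" by simp
      then show ?thesis by blast
    next
      fix u assume u: "\<forall>j<n. (\<Sum>x\<in>X. u x * w j x) = 0" "(\<Sum>x\<in>X. u x * f x) \<noteq> 0"
      have "(\<Sum>x\<in>X. u x * w n x) = (\<Sum>x\<in>X. \<Sum>j<n. c j * (u x * w j x))"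
        by (intro sum.cong refl) (simp add: c sum_distrib_left mult_ac)
      also have "\<dots> = (\<Sum>j<n. c j * (\<Sum>x\<in>X. u x * w j x))"
        by (subst sum.swap) (simp add: sum_distrib_left)
      also have "\<dots> = 0" using u by simp
      finally show ?thesis using u by (auto simp: less_Suc_eq)
    qed
  next
    assume "\<exists>u. (\<forall>j<n. (\<Sum>x\<in>X. u x * w j x) = 0) \<and> (\<Sum>x\<in>X. u x * w n x) \<noteq> 0"
    then obtain u where u: "\<And>j. j < n \<Longrightarrow> (\<Sum>x\<in>X. u x * w j x) = 0"
      "(\<Sum>x\<in>X. u x * w n x) \<noteq> 0" by blast
    \<comment> \<open>With this t the functional u vanishes on f - t \<open>w n\<close>.\<close>
    define t where "t = (\<Sum>x\<in>X. u x * f x) / (\<Sum>x\<in>X. u x * w n x)"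
    from Suc.IH[of "\<lambda>x. f x - t * w n x"] show ?thesis
    proof (elim disjE exE conjE)
      fix d assume "\<forall>x\<in>X. f x - t * w n x = (\<Sum>j<n. d j * w j x)"
      then have "\<forall>x\<in>X. f x = (\<Sum>j<Suc n. (d(n := t)) j * w j x)"
        by (auto simp: algebra_simps)
      then show ?thesis by blast
    next
      fix v assume v: "\<forall>j<n. (\<Sum>x\<in>X. v x * w j x) = 0" "(\<Sum>x\<in>X. v x * (f x - t * w n x)) \<noteq> 0"
      \<comment> \<open>With this s the functional v - s u kills \<open>w n\<close> too. Since u
        vanishes on f - t \<open>w n\<close>, its value at f equals that of v at f - t
        \<open>w n\<close>.\<close>
      define s where "s = (\<Sum>x\<in>X. v x * w n x) / (\<Sum>x\<in>X. u x * w n x)"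
      have lin: "(\<Sum>x\<in>X. (v x - s * u x) * g x) = (\<Sum>x\<in>X. v x * g x) - s * (\<Sum>x\<in>X. u x * g x)" for g
        by (simp add: left_diff_distrib sum_subtractf sum_distrib_left mult.assoc)
      have "(\<Sum>x\<in>X. v x * (f x - t * w n x)) = (\<Sum>x\<in>X. v x * f x) - t * (\<Sum>x\<in>X. v x * w n x)"
        by (simp add: right_diff_distrib sum_subtractf sum_distrib_left mult_ac)
      also have "\<dots> = (\<Sum>x\<in>X. (v x - s * u x) * f x)"
        unfolding lin using u(2) by (simp add: s_def t_def)
      finally have "(\<Sum>x\<in>X. (v x - s * u x) * f x) \<noteq> 0" using v(2) by simp
      moreover have "(\<Sum>x\<in>X. (v x - s * u x) * w j x) = 0" if "j < Suc n" for j
        unfolding lin using that u v(1) by (cases "j = n") (auto simp: s_def)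
      ultimately show ?thesis by (intro disjI2 exI[of _ "\<lambda>x. v x - s * u x"]) auto
    qed
  qed
qed

text \<open>A functional that vanishes on the span but not at f is continuous, so it keeps f at a
  positive distance from the span.\<close>

lemma finite_span_closed:
  fixes f :: "'x \<Rightarrow> complex" and w :: "nat \<Rightarrow> 'x \<Rightarrow> complex"
  assumes "finite X"
    and approx: "\<And>\<epsilon>. \<epsilon> > 0 \<Longrightarrow> \<exists>c. (\<Sum>x\<in>X. (cmod (f x - (\<Sum>j<n. c j * w j x)))\<^sup>2) < \<epsilon>"
  shows "\<exists>c. \<forall>x\<in>X. f x = (\<Sum>j<n. c j * w j x)"
proof (rule ccontr)
  assume "\<not> ?thesis"
  then obtain u where u: "\<And>j. j < n \<Longrightarrow> (\<Sum>x\<in>X. u x * w j x) = 0" "(\<Sum>x\<in>X. u x * f x) \<noteq> 0"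
    using span_or_separating_functional[OF assms(1), where f = f and n = n and w = w] by blast
  define s where "s = cmod (\<Sum>x\<in>X. u x * f x)"
  define U where "U = (\<Sum>x\<in>X. cmod (u x))"
  \<comment> \<open>Adding 1 avoids a zero denominator and makes U times this bound strictly less
    than s.\<close>
  define \<delta> where "\<delta> = s / (U + 1)"
  have "s > 0" "U \<ge> 0" using u(2) by (auto simp: s_def U_def sum_nonneg)
  then have \<delta>: "\<delta> > 0" "U * \<delta> < s" by (auto simp: \<delta>_def field_simps)
  obtain c where c: "(\<Sum>x\<in>X. (cmod (f x - (\<Sum>j<n. c j * w j x)))\<^sup>2) < \<delta>\<^sup>2"
    using approx[of "\<delta>\<^sup>2"] \<delta> by auto
  define h where "h x = (\<Sum>j<n. c j * w j x)" for x
  have "(cmod (f x - h x))\<^sup>2 \<le> \<delta>\<^sup>2" if "x \<in> X" for x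
    using member_le_sum[of x X "\<lambda>x. (cmod (f x - h x))\<^sup>2"] that assms(1) c by (simp add: h_def)
  then have small: "cmod (f x - h x) \<le> \<delta>" if "x \<in> X" for x
    using that \<delta>(1) by (simp add: abs_le_square_iff[symmetric])
  have "(\<Sum>x\<in>X. u x * h x) = (\<Sum>x\<in>X. \<Sum>j<n. c j * (u x * w j x))"
    by (intro sum.cong refl) (simp add: h_def sum_distrib_left mult_ac)
  also have "\<dots> = (\<Sum>j<n. c j * (\<Sum>x\<in>X. u x * w j x))"
    by (subst sum.swap) (simp add: sum_distrib_left)
  also have "\<dots> = 0" using u(1) by simp
  finally have "s = cmod (\<Sum>x\<in>X. u x * (f x - h x))"
    by (simp add: s_def right_diff_distrib sum_subtractf)
  also have "\<dots> \<le> (\<Sum>x\<in>X. cmod (u x) * cmod (f x - h x))"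
    by (rule order.trans[OF norm_sum]) (simp add: norm_mult)
  also have "\<dots> \<le> (\<Sum>x\<in>X. cmod (u x) * \<delta>)"
    by (intro sum_mono mult_left_mono small) auto
  also have "\<dots> = U * \<delta>" by (simp add: U_def sum_distrib_right)
  finally show False using \<delta>(2) by simp
qed

subsection \<open>Periodic sequences and the discrete Fourier transform\<close>

lemma periodic_mod:
  fixes F :: "int \<Rightarrow> 'a"
  assumes "\<And>i. F (i + int N) = F i"
  shows "F (i mod int N) = F i"
proof -
  have *: "F (i + int k * int N) = F i" for i k
  proof (induction k)
    case (Suc k)
    have "F (i + int (Suc k) * int N) = F (i + int k * int N + int N)"
      by (simp add: algebra_simps)
    then show ?case using Suc assms by simp
  qed simp
  have "F (i + j * int N) = F i" for i j
    using *[of i "nat j"] *[of "i + j * int N" "nat (- j)"] by (cases "j \<ge> 0") auto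
  from this[of "i mod int N" "i div int N"] show ?thesis by (simp add: mod_mult_div_eq mult.commute)
qed

lemma sum_periodic_shift:
  fixes F :: "int \<Rightarrow> 'a::comm_monoid_add"
  assumes "N > 0" "\<And>i. F (i + int N) = F i"
  shows "(\<Sum>i\<in>{0..<int N}. F (i + k)) = (\<Sum>i\<in>{0..<int N}. F i)"
  by (rule sum.reindex_bij_witness[where i = "\<lambda>i. (i - k) mod int N" and j = "\<lambda>i. (i + k) mod int N"])
    (use assms(1) periodic_mod[of F, OF assms(2)] in \<open>auto simp: mod_simps\<close>)

lemma sum_periodic_multiple:
  fixes F :: "int \<Rightarrow> 'a::comm_semiring_1"
  assumes "\<And>i. F (i + int N) = F i"
  shows "(\<Sum>i\<in>{0..<int (N * k)}. F i) = of_nat k * (\<Sum>i\<in>{0..<int N}. F i)"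
proof (induction k)
  case (Suc k)
  have shift: "(\<lambda>i. i + int (N * k)) ` {0..<int N} = {int (N * k)..<int (N * Suc k)}"
    using image_add_int_atLeastLessThan[of "int (N * k)" "int (N * Suc k)"] by simp
  have "{0..<int (N * Suc k)} = {0..<int (N * k)} \<union> (\<lambda>i. i + int (N * k)) ` {0..<int N}"
    unfolding shift by (subst ivl_disj_un_two) auto
  moreover have "F (i + int (N * k)) = F i" for i
    using periodic_mod[of F N, OF assms] by (metis mod_mult_self2 of_nat_mult)
  then have "(\<Sum>i\<in>(\<lambda>i. i + int (N * k)) ` {0..<int N}. F i) = (\<Sum>i\<in>{0..<int N}. F i)"
    by (subst sum.reindex) auto
  ultimately show ?case using Suc
    by (simp only:, subst sum.union_disjoint) (auto simp: algebra_simps)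
qed simp

lemma sum_int_atLeastLessThan: "(\<Sum>i\<in>{0..<int n}. F i) = (\<Sum>i<n. F (int i))"
  by (rule sum.reindex_bij_witness[where i = int and j = nat]) auto

lemma cis_2pi_eq_1_iff: "cis (2 * pi * x) = 1 \<longleftrightarrow> x \<in> \<int>"
proof
  assume "cis (2 * pi * x) = 1"
  then have "cos (2 * pi * x) = 1" by (metis cis.sel(1) one_complex.sel(1))
  then obtain k :: int where "2 * pi * x = k * 2 * pi" by (auto simp: cos_one_2pi_int)
  then have "x = of_int k" by simp
  then show "x \<in> \<int>" by simp
qed simp

lemma cis_2pi_inj_on:
  assumes "N > 0"
  shows "inj_on (\<lambda>l::nat. cis (2 * pi * (real l / real N))) {..<N}"
proof (rule inj_onI)
  fix k l assume kl: "k \<in> {..<N}" "l \<in> {..<N}"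
    and "cis (2 * pi * (real k / real N)) = cis (2 * pi * (real l / real N))"
  then have "cis (2 * pi * (real k / real N)) / cis (2 * pi * (real l / real N)) = 1" by simp
  then have "cis (2 * pi * ((real k - real l) / real N)) = 1"
    by (simp add: cis_divide diff_divide_distrib right_diff_distrib)
  then obtain j where "(real k - real l) / real N = of_int j"
    unfolding cis_2pi_eq_1_iff by (auto elim: Ints_cases)
  then have "real_of_int (int k - int l) = real_of_int (j * int N)"
    using assms by (simp add: field_simps)
  then have "int k - int l = j * int N" by linarith
  moreover have "\<bar>int k - int l\<bar> < int N" using kl by auto
  ultimately have "\<bar>j\<bar> * int N < 1 * int N" by (simp add: abs_mult)
  then have "j = 0" by (subst (asm) mult_less_cancel_right) auto
  then show "k = l" using \<open>int k - int l = j * int N\<close> by simp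
qed

text \<open>The transform is unnormalised and has the positive sign in the exponent, to match the
  character in \<open>qp_fourier\<close>. Sequences and frequencies range over all integers, so
  shifts need no reduction modulo n.\<close>

definition dft :: "nat \<Rightarrow> (int \<Rightarrow> complex) \<Rightarrow> int \<Rightarrow> complex" where
  "dft n g l = (\<Sum>i\<in>{0..<int n}. cis (2 * pi * (of_int (l * i) / real n)) * g i)"

lemma cis_2pi_of_int_div_add:
  assumes "n > 0"
  shows "cis (2 * pi * (of_int (l + k * int n) / real n)) = cis (2 * pi * (of_int l / real n))"
proof -
  have "2 * pi * (of_int (l + k * int n) / real n) = 2 * pi * (of_int l / real n) + 2 * pi * of_int k"
    using assms by (simp add: field_simps)
  then show ?thesis using cis_mult[of "2 * pi * (of_int l / real n)" "2 * pi * of_int k"] by simp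
qed

lemma dft_add_period:
  assumes "n > 0"
  shows "dft n g (l + int n) = dft n g l"
proof -
  have "(l + int n) * i = l * i + i * int n" for i by (simp add: algebra_simps)
  then show ?thesis unfolding dft_def by (simp only: cis_2pi_of_int_div_add[OF assms])
qed

lemma dft_shift:
  assumes "n > 0" "\<And>i. g (i + int n) = g i"
  shows "dft n (\<lambda>i. g (i - k)) l = cis (2 * pi * (of_int (l * k) / real n)) * dft n g l"
proof -
  let ?F = "\<lambda>i. cis (2 * pi * (of_int (l * i) / real n)) * g (i - k)"
  have per: "?F (i + int n) = ?F i" for i
    using assms cis_2pi_of_int_div_add[OF assms(1), of "l * i" l] assms(2)[of "i - k"]
    by (simp add: algebra_simps)
  have "dft n (\<lambda>i. g (i - k)) l = (\<Sum>i\<in>{0..<int n}. ?F (i + k))"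
    unfolding dft_def by (rule sum_periodic_shift[where F = ?F, symmetric]) (use assms per in auto)
  also have "\<dots> = cis (2 * pi * (of_int (l * k) / real n)) * dft n g l"
    unfolding dft_def sum_distrib_left
    by (intro sum.cong refl) (simp add: cis_mult[symmetric] add_divide_distrib distrib_left mult_ac)
  finally show ?thesis .
qed

text \<open>Periodicity in position becomes sparsity in frequency: an n-periodic sequence read with
  length n p has spectrum on the multiples of p only.\<close>

lemma dft_multiple_period:
  assumes "n > 0" "p > 0" "\<And>i. g (i + int n) = g i"
  shows "dft (n * p) g l = (if int p dvd l then of_nat p * dft n g (l div int p) else 0)"
proof (cases "int p dvd l")
  case True
  then obtain l' where l: "l = int p * l'" by blast
  let ?F = "\<lambda>i. cis (2 * pi * (of_int (l' * i) / real n)) * g i"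
  have "dft (n * p) g l = (\<Sum>i\<in>{0..<int (n * p)}. ?F i)"
    unfolding dft_def l using assms by (intro sum.cong refl) simp
  also have "\<dots> = of_nat p * (\<Sum>i\<in>{0..<int n}. ?F i)"
  proof (rule sum_periodic_multiple)
    show "?F (i + int n) = ?F i" for i
      using assms cis_2pi_of_int_div_add[OF assms(1), of "l' * i" l'] by (simp add: algebra_simps)
  qed
  finally show ?thesis using l assms(2) by (simp add: dft_def)
next
  case False
  have per: "g (i + int (n * p)) = g i" for i
    using periodic_mod[of g n, OF assms(3)] by (metis mod_mult_self2 of_nat_mult)
  \<comment> \<open>The shift by n fixes g but multiplies its transform by a p-th root of unity,
    which differs from 1 as p does not divide l; hence the transform is zero.\<close>
  have "(\<lambda>i. g (i - int n)) = g" using assms(3)[of "_ - int n"] by auto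
  then have "dft (n * p) g l = cis (2 * pi * (of_int (l * int n) / real (n * p))) * dft (n * p) g l"
    using dft_shift[of "n * p" g "int n" l] assms per by simp
  moreover have "of_int (l * int n) / real (n * p) = of_int l / real p"
    using assms by simp
  moreover have "of_int l / real p \<notin> \<int>"
  proof
    assume "of_int l / real p \<in> \<int>"
    then obtain j where "of_int l / real p = of_int j" by (auto elim: Ints_cases)
    then have "real_of_int l = real_of_int (int p * j)" using assms by (simp add: field_simps)
    then show False using False by (metis dvd_triv_left of_int_eq_iff)
  qed
  ultimately have "dft (n * p) g l = 0"
    using cis_2pi_eq_1_iff[of "of_int l / real p"] by auto
  then show ?thesis using False by simp
qed

text \<open>Only positions i = p j contribute, and there the phase l i / (n p) equals l j /
  n.\<close>

lemma dft_upsample: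
  assumes "n > 0" "p > 0"
  shows "dft (n * p) (\<lambda>i. if int p dvd i then g (i div int p) else 0) l = dft n g l"
proof -
  have "dft (n * p) (\<lambda>i. if int p dvd i then g (i div int p) else 0) l
    = (\<Sum>i\<in>{i \<in> {0..<int (n * p)}. int p dvd i}.
        cis (2 * pi * (of_int (l * i) / real (n * p))) * g (i div int p))"
    unfolding dft_def by (rule sum.mono_neutral_cong_right) auto
  also have "\<dots> = dft n g l"
    unfolding dft_def
  proof (rule sum.reindex_bij_witness[where i = "\<lambda>i. int p * i" and j = "\<lambda>i. i div int p"])
    fix i assume i: "i \<in> {i \<in> {0..<int (n * p)}. int p dvd i}"
    then obtain j where j: "i = int p * j" by blast
    show "int p * (i div int p) = i" using j assms by simp
    show "i div int p \<in> {0..<int n}"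
      using i j assms by (simp add: zero_le_mult_iff mult.commute[of "int n"])
    show "cis (2 * pi * (of_int (l * (i div int p)) / real n)) * g (i div int p)
        = cis (2 * pi * (of_int (l * i) / real (n * p))) * g (i div int p)"
      using j assms by simp
  next
    fix i assume i: "i \<in> {0..<int n}"
    then show "int p * i \<in> {i \<in> {0..<int (n * p)}. int p dvd i}" "int p * i div int p = i"
      using assms by (auto simp: mult.commute[of "int n"])
  qed
  finally show ?thesis .
qed

text \<open>Writing the count as a sum over an integer interval lets
  \<open>sum_periodic_multiple\<close> count over several periods.\<close>

lemma card_filter_lessThan:
  "card {l \<in> {..<n::nat}. P (int l)} = (\<Sum>i\<in>{0..<int n}. if P i then 1 else 0)"
  unfolding sum_int_atLeastLessThan card_eq_sum by (rule sum.inter_filter) simp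

section \<open>Counting roots of the refinement polynomials\<close>

lemma card_dft_support_le:
  fixes g :: "int \<Rightarrow> complex" and m :: "nat \<Rightarrow> nat \<Rightarrow> complex"
  assumes n: "n > 0" and p: "p > 1" and q: "q > 0"
    and per: "\<And>i. g (i + int n) = g i"
    and refine: "\<And>b i. b < q \<Longrightarrow> i < n * p \<Longrightarrow> g (int i - int b) =
      (\<Sum>k<p * q. m b k * (if int p dvd int i - int k then g ((int i - int k) div int p) else 0))"
  shows "card {l \<in> {..<n}. dft n g (int l) \<noteq> 0} \<le> q"
proof (rule ccontr)
  define S where "S = {l \<in> {..<n}. dft n g (int l) \<noteq> 0}"
  assume "\<not> ?thesis"
  then have S: "q < card S" by (simp add: S_def)
  define z where "z l = cis (2 * pi * (real l / real (n * p)))" for l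
  define y where "y l = cis (2 * pi * (real l / real n))" for l
  define G where "G i = (if int p dvd i then g (i div int p) else 0)" for i
  have np: "n * p > 0" using n p by simp
  have per_np: "g (i + int (n * p)) = g i" for i
    using periodic_mod[of g n, OF per] by (metis mod_mult_self2 of_nat_mult)
  have per_G: "G (i + int (n * p)) = G i" for i
  proof -
    have "(i + int (n * p)) div int p = i div int p + int n" if "int p dvd i"
      using p that by (auto simp: distrib_left[symmetric] mult.commute[of "int n"])
    then show ?thesis using per by (auto simp: G_def dvd_add_left_iff)
  qed
  \<comment> \<open>Transform of order n p of the refinement equation: translates give powers of
    \<open>z l\<close>, upsampling gives the factor at l, and the n-periodic side lives on multiples
    of p, where \<open>z l\<close> is \<open>y (l div p)\<close>.\<close>
  have key: "(\<Sum>k<p * q. m b k * z l ^ k) * dft n g (int l) =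
      (if p dvd l then of_nat p * (y (l div p) ^ b * dft n g (int (l div p))) else 0)"
    if b: "b < q" for b l
  proof -
    have "(\<Sum>k<p * q. m b k * z l ^ k) * dft n g (int l)
      = (\<Sum>k<p * q. m b k * (cis (2 * pi * (of_int (int l * int k) / real (n * p))) * dft (n * p) G (int l)))"
      unfolding G_def dft_upsample[OF n order.strict_trans[OF zero_less_one p]] sum_distrib_right
      by (intro sum.cong refl) (simp add: z_def DeMoivre mult_ac)
    also have "\<dots> = (\<Sum>k<p * q. m b k * dft (n * p) (\<lambda>i. G (i - int k)) (int l))"
      by (simp only: dft_shift[of "n * p" G, OF np per_G])
    also have "\<dots> = dft (n * p) (\<lambda>i. \<Sum>k<p * q. m b k * G (i - int k)) (int l)"
      unfolding dft_def sum_distrib_left by (subst sum.swap) (simp add: mult_ac)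
    also have "\<dots> = dft (n * p) (\<lambda>i. g (i - int b)) (int l)"
      unfolding dft_def sum_int_atLeastLessThan
      by (intro sum.cong refl) (use refine[OF b] in \<open>simp add: G_def\<close>)
    also have "\<dots> = cis (2 * pi * (of_int (int l * int b) / real (n * p))) * dft (n * p) g (int l)"
      by (rule dft_shift[of "n * p" g, OF np per_np])
    also have "\<dots> = (if p dvd l then of_nat p * (y (l div p) ^ b * dft n g (int (l div p))) else 0)"
      using p by (auto simp: dft_multiple_period[of n p g, OF n _ per] y_def DeMoivre zdiv_int mult_ac elim!: dvdE)
    finally show ?thesis .
  qed
  define R where "R = {l \<in> {..<n * p}. dft n g (int l) \<noteq> 0}"
  define U where "U = {l \<in> {..<n * p}. p dvd l \<and> dft n g (int (l div p)) \<noteq> 0}"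
  \<comment> \<open>The transform has period n in l, and R runs through p periods.\<close>
  have "card R = p * card S"
    unfolding R_def S_def card_filter_lessThan[of _ "\<lambda>i. dft n g i \<noteq> 0"]
    using sum_periodic_multiple[of "\<lambda>i. if dft n g i \<noteq> 0 then 1 else (0::nat)" n p]
    by (simp add: dft_add_period[OF n])
  moreover have "card U = card S"
    by (rule bij_betw_same_card[symmetric, of "\<lambda>l. p * l"], rule bij_betw_byWitness[where f' = "\<lambda>l. l div p"])
      (use p in \<open>auto simp: S_def U_def mult.commute[of n] elim!: dvdE\<close>)
  \<comment> \<open>For b = 0 the right side of \<open>key\<close> is nonzero at each point of U,
    which forces a nonzero transform there.\<close>
  moreover have "U \<subseteq> R"
  proof
    fix l assume "l \<in> U"
    then show "l \<in> R" using key[OF q, of l] p by (auto simp: U_def R_def)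
  qed
  ultimately have card_T: "card (R - U) = p * card S - card S"
    by (subst card_Diff_subset) (auto simp: U_def)
  define t where "t = card (R - U)"
  \<comment> \<open>On R - U the right side of \<open>key\<close> is zero while the transform on the
    left is not.\<close>
  have root: "(\<Sum>k<p * q. m b k * z l ^ k) = 0" if "l \<in> R - U" "b < q" for l b
    using key[OF that(2), of l] that(1) by (auto simp: R_def U_def split: if_splits)
  have "(p - 1) * q < (p - 1) * card S" using S p by simp
  \<comment> \<open>There are fewer top coefficients to annihilate, p q - (p - 1) #S at most, than
    polynomials \<open>m b\<close> to combine, namely q.\<close>
  then have "card {t..<p * q} < card {..<q}"
    using q card_T by (simp add: t_def diff_mult_distrib)
  then obtain c where c: "\<exists>b\<in>{..<q}. c b \<noteq> 0"
    "\<And>k. k \<in> {t..<p * q} \<Longrightarrow> (\<Sum>b<q. c b * m b k) = 0"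
    using nontrivial_solution[of "{t..<p * q}" "{..<q}" m] by (meson finite_atLeastLessThan finite_lessThan)
  \<comment> \<open>Coefficients of the combination, extended by 0 beyond p q because t may exceed p
    q.\<close>
  define d where "d k = (if k < p * q then \<Sum>b<q. c b * m b k else 0)" for k
  have d_sum: "(\<Sum>k<p * q. d k * x ^ k) = (\<Sum>b<q. c b * (\<Sum>k<p * q. m b k * x ^ k))" for x
    unfolding d_def sum_distrib_left by (subst sum.swap) (simp add: sum_distrib_right mult.assoc)
  have d_t: "(\<Sum>k<t. d k * x ^ k) = (\<Sum>k<p * q. d k * x ^ k)" for x
  proof -
    have z: "d k = 0" if "t \<le> k \<or> p * q \<le> k" for k
      using c(2)[of k] that by (cases "k < p * q") (auto simp: d_def)
    have "(\<Sum>k<t. d k * x ^ k) = (\<Sum>k<max t (p * q). d k * x ^ k)"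
      by (rule sum.mono_neutral_left) (auto simp: z)
    also have "\<dots> = (\<Sum>k<p * q. d k * x ^ k)"
      by (rule sum.mono_neutral_right) (auto simp: z)
    finally show ?thesis .
  qed
  have d0: "d k = 0" if "k < t" for k
  proof (rule coeffs_eq_0_if_many_roots[where Z = "z ` (R - U)"])
    have "inj_on z (R - U)"
      using inj_on_subset[OF cis_2pi_inj_on[OF np], of "R - U"] by (auto simp: z_def[abs_def] R_def)
    then show "t \<le> card (z ` (R - U))" by (simp add: card_image t_def)
    show "(\<Sum>k<t. d k * x ^ k) = 0" if "x \<in> z ` (R - U)" for x
      using that root unfolding d_t d_sum by auto
  qed (use that in \<open>auto simp: R_def\<close>)
  \<comment> \<open>The combination has degree less than t and t distinct roots, so it vanishes
    identically.\<close>
  have all0: "(\<Sum>b<q. c b * (\<Sum>k<p * q. m b k * x ^ k)) = 0" for x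
    unfolding d_sum[symmetric] d_t[symmetric] using d0 by simp
  have "c b = 0" if "b < q" for b
  proof (rule coeffs_eq_0_if_many_roots[where Z = "y ` S"])
    have "inj_on y S"
      using inj_on_subset[OF cis_2pi_inj_on[OF n], of S] by (auto simp: y_def[abs_def] S_def)
    then show "q \<le> card (y ` S)" using S by (simp add: card_image)
    show "(\<Sum>b<q. c b * x ^ b) = 0" if x: "x \<in> y ` S" for x
    proof -
      obtain l where l: "l \<in> S" "x = y l" using x by blast
      \<comment> \<open>Evaluating the vanishing combination at \<open>z (p * l)\<close> for l in S
        turns it, through \<open>key\<close>, into the combination of the powers of
        \<open>y l\<close>. These are more than q distinct roots for a polynomial of degree less
        than q.\<close>
      have "(\<Sum>b<q. c b * x ^ b) * (of_nat p * dft n g (int l))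
        = (\<Sum>b<q. c b * (of_nat p * (y l ^ b * dft n g (int l))))"
        unfolding l(2) by (simp add: sum_distrib_left mult_ac)
      also have "\<dots> = (\<Sum>b<q. c b * ((\<Sum>k<p * q. m b k * z (p * l) ^ k) * dft n g (int (p * l))))"
        by (intro sum.cong refl) (use key[of _ "p * l"] p in simp)
      also have "\<dots> = (\<Sum>b<q. c b * (\<Sum>k<p * q. m b k * z (p * l) ^ k)) * dft n g (int (p * l))"
        by (simp add: sum_distrib_right mult.assoc)
      also have "\<dots> = 0" by (simp add: all0)
      finally show ?thesis using l(1) p by (simp add: S_def)
    qed
  qed (use that in \<open>auto simp: S_def\<close>)
  then show False using c(1) by blast
qed

subsection \<open>Restriction to finite grids\<close>

text \<open>Both sums run over grid points in [0, P^L). The points that only the finer grid has lie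
  outside the support.\<close>

lemma sum_grid_refine:
  fixes F :: "real \<Rightarrow> 'a::comm_monoid_add"
  assumes P: "P > 0" and "B \<le> K"
    and supp: "\<And>r. r \<in> Z_inv P \<Longrightarrow> F r \<noteq> 0 \<Longrightarrow> r * real P ^ B \<in> \<int>"
  shows "(\<Sum>i<P ^ (L + K). F (real i / real P ^ K)) = (\<Sum>j<P ^ (L + B). F (real j / real P ^ B))"
proof -
  define Q where "Q = P ^ (K - B)"
  have Q: "Q > 0" "P ^ K = P ^ B * Q" "P ^ (L + K) = P ^ (L + B) * Q"
    using assms by (auto simp: Q_def power_add[symmetric])
  have Q': "real P ^ K = real P ^ B * real Q"
    using Q(2) by (metis of_nat_mult of_nat_power)
  define H where "H i = F (real i / real P ^ K)" for i
  have "sum H {..<P ^ (L + K)} = sum H ((\<lambda>j. j * Q) ` {..<P ^ (L + B)})"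
  proof (rule sum.mono_neutral_right)
    show "(\<lambda>j. j * Q) ` {..<P ^ (L + B)} \<subseteq> {..<P ^ (L + K)}" using Q by auto
    show "\<forall>i\<in>{..<P ^ (L + K)} - (\<lambda>j. j * Q) ` {..<P ^ (L + B)}. H i = 0"
    proof (rule ballI, rule ccontr)
      fix i assume i: "i \<in> {..<P ^ (L + K)} - (\<lambda>j. j * Q) ` {..<P ^ (L + B)}"
        and "H i \<noteq> 0"
      then have "real i / real P ^ K * real P ^ B \<in> \<int>"
        unfolding H_def by (intro supp Z_inv_div_power[OF P]) auto
      then have "real i / real Q \<in> \<int>" using P by (simp add: Q')
      then have "Q dvd i"
        using Q(1) of_int_div_of_int_in_Ints_iff[of "int i" "int Q", where ?'a = real] by simp
      then obtain j where "i = j * Q" by (metis dvdE mult.commute)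
      then show False using i Q by auto
    qed
  qed simp
  also have "\<dots> = (\<Sum>j<P ^ (L + B). F (real j / real P ^ B))"
    using Q(1) P by (subst sum.reindex) (auto simp: inj_on_def H_def Q')
  finally show ?thesis by (simp add: H_def)
qed

text \<open>Evaluates the Haar integral as a finite sum over one period. Only values on Z[1/p]
  enter, so f is described by a function F there.\<close>

lemma qp_integral_periodic:
  fixes f :: "'p::finite qp \<Rightarrow> complex" and F :: "real \<Rightarrow> complex"
  defines "P \<equiv> CARD('p)"
  assumes per: "\<And>r. r \<in> Z_inv P \<Longrightarrow> F (r + real P ^ A) = F r"
    and supp: "\<And>r. r \<in> Z_inv P \<Longrightarrow> F r \<noteq> 0 \<Longrightarrow> r * real P ^ B \<in> \<int>"
    and f: "\<And>r. r \<in> Z_inv P \<Longrightarrow> f (qp_of_real r) = F r"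
  shows "qp_integral f = (\<Sum>i<P ^ (A + B). F (real i / real P ^ B)) / of_nat P ^ A"
proof -
  have P: "P > 0" by (simp add: P_def)
  let ?I = "(\<Sum>i<P ^ (A + B). F (real i / real P ^ B)) / of_nat P ^ A"
  let ?R = "\<lambda>K k. complex_of_real (real P powi (- int k)) *
    (\<Sum>i<P ^ (K + k). f (qp_of_real (real i / real P ^ K)))"
  have *: "?I = ?R K k" if "K \<ge> max A B" "k \<ge> max A B" for K k
  proof -
    let ?G = "\<lambda>i::int. F (of_int i / real P ^ B)"
    have G: "?G (i + int (P ^ (A + B))) = ?G i" for i
      using per[of "of_int i / real P ^ B"] Z_inv_div_power[OF P, of "of_int i" B] P
      by (simp add: add_divide_distrib power_add)
    have pow: "P ^ (A + B) * P ^ (k - A) = P ^ (k + B)"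
      using that by (simp add: power_add[symmetric] add.commute)
    have "(\<Sum>i<P ^ (K + k). f (qp_of_real (real i / real P ^ K))) = (\<Sum>i<P ^ (k + K). F (real i / real P ^ K))"
      by (simp add: f Z_inv_div_power[OF P] add.commute)
    \<comment> \<open>First the grid is coarsened to step P^(-B); the interval of length P^k then
      splits into P^(k-A) periods, and the factor P^(-k) leaves P^(-A).\<close>
    also have "\<dots> = (\<Sum>i<P ^ (k + B). F (real i / real P ^ B))"
      by (rule sum_grid_refine[OF P _ supp]) (use that in auto)
    also have "\<dots> = (\<Sum>i\<in>{0..<int (P ^ (A + B) * P ^ (k - A))}. ?G i)"
      unfolding pow by (simp only: sum_int_atLeastLessThan of_int_of_nat_eq)
    also have "\<dots> = of_nat (P ^ (k - A)) * (\<Sum>i\<in>{0..<int (P ^ (A + B))}. ?G i)"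
      by (rule sum_periodic_multiple[of ?G, OF G])
    also have "(\<Sum>i\<in>{0..<int (P ^ (A + B))}. ?G i) = (\<Sum>i<P ^ (A + B). F (real i / real P ^ B))"
      by (simp only: sum_int_atLeastLessThan of_int_of_nat_eq)
    finally have "?R K k = (of_nat P ^ (k - A) / of_nat P ^ k) * (\<Sum>i<P ^ (A + B). F (real i / real P ^ B))"
      by (simp add: power_int_minus divide_inverse mult_ac)
    also have "(of_nat P ^ (k - A) / of_nat P ^ k :: complex) = 1 / of_nat P ^ A"
      using that P power_add[of "of_nat P :: complex" "k - A" A] by (simp add: field_simps)
    finally show ?thesis by simp
  qed
  show ?thesis
    unfolding qp_integral_def P_def[symmetric]
  proof (rule the_equality)
    show "\<exists>K0. \<forall>K\<ge>K0. \<forall>k\<ge>K0. ?I = ?R K k" using * by blast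
  next
    fix I assume "\<exists>K0. \<forall>K\<ge>K0. \<forall>k\<ge>K0. I = ?R K k"
    then obtain K0 where "I = ?R K k" if "K \<ge> K0" "k \<ge> K0" for K k by blast
    then show "I = ?I" using *[of "max K0 (max A B)" "max K0 (max A B)"] by simp
  qed
qed

text \<open>On the grid of step P^(-N) a generator with shift \<open>\<alpha> i\<close> is either a
  translate of the upsampled g, when \<open>\<alpha> i\<close> P^(N+1) is an integer k, or zero. The
  bound k < P^(N+1) comes from \<open>\<alpha> i\<close> < 1.\<close>

lemma cspan_translates_on_grid:
  fixes g :: "int \<Rightarrow> complex" and \<Phi> :: "real \<Rightarrow> complex" and \<alpha> :: "nat \<Rightarrow> real"
  assumes P: "P > 0"
    and g: "\<And>i. g i = \<Phi> (of_int i / real P ^ N)"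
    and supp: "\<And>r. r \<in> Z_inv P \<Longrightarrow> \<Phi> r \<noteq> 0 \<Longrightarrow> r * real P ^ N \<in> \<int>"
    and \<alpha>: "\<And>i. i < n \<Longrightarrow> \<alpha> i \<in> Z_inv P" "\<And>i. i < n \<Longrightarrow> 0 \<le> \<alpha> i" "\<And>i. i < n \<Longrightarrow> \<alpha> i < 1"
  shows "\<exists>c'. \<forall>j. (\<Sum>i<n. c i * \<Phi> (of_int j / real P ^ N / real P - \<alpha> i)) =
    (\<Sum>k<P * P ^ N. c' k * (if int P dvd j - int k then g ((j - int k) div int P) else 0))"
proof -
  define G where "G i = (if int P dvd i then g (i div int P) else 0)" for i
  have PN: "real P ^ N * real P > 0" using P by simp
  have G: "\<Phi> (of_int i / (real P ^ N * real P)) = G i" for i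
  proof (cases "int P dvd i")
    case True
    then show ?thesis using P by (auto simp: G_def g elim!: dvdE)
  next
    case False
    have "of_int i / (real P ^ N * real P) \<in> Z_inv P"
      using Z_inv_div_power[OF P, of "of_int i" "Suc N"] by (simp add: mult.commute)
    moreover have "of_int i / (real P ^ N * real P) * real P ^ N \<notin> \<int>"
      using False P of_int_div_of_int_in_Ints_iff[of i "int P", where ?'a = real] by simp
    ultimately have "\<Phi> (of_int i / (real P ^ N * real P)) = 0" using supp by blast
    then show ?thesis using False by (simp add: G_def)
  qed
  have single: "\<Phi> (of_int j / real P ^ N / real P - \<alpha> i) =
      (\<Sum>k<P * P ^ N. if \<alpha> i * (real P ^ N * real P) = real k then G (j - int k) else 0)" (is "?l = ?r")
    if i: "i < n" for i j
  proof (cases "\<alpha> i * (real P ^ N * real P) \<in> \<int>")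
    case True
    then obtain k' where k': "\<alpha> i * (real P ^ N * real P) = of_int k'" by (auto elim: Ints_cases)
    have "0 \<le> real_of_int k'" "real_of_int k' < real P ^ N * real P"
      unfolding k'[symmetric] using \<alpha>(2)[OF i] mult_strict_right_mono[OF \<alpha>(3)[OF i] PN] PN by auto
    then have "0 \<le> k'" "k' < int (P * P ^ N)"
      by (simp_all add: mult.commute flip: of_int_less_iff[where ?'a = real])
    then obtain k where k: "k' = int k" "k < P * P ^ N" by (metis nonneg_int_cases of_nat_less_iff)
    have "?r = (\<Sum>k''<P * P ^ N. if k'' = k then G (j - int k) else 0)"
      unfolding k' k by (intro sum.cong refl) auto
    also have "\<dots> = G (j - int k)" using k by simp
    also have "\<dots> = ?l"
    proof -
      have "\<alpha> i = real k / (real P ^ N * real P)" using k' k P by (intro eq_divide_imp) auto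
      then show ?thesis unfolding G[symmetric] by (simp add: diff_divide_distrib)
    qed
    finally show ?thesis by simp
  next
    case False
    \<comment> \<open>If the argument met the support, \<open>\<alpha> i\<close> P^(N+1) would be a
      difference of integers.\<close>
    have "(of_int j / real P ^ N / real P - \<alpha> i) * real P ^ N \<notin> \<int>"
    proof
      assume "(of_int j / real P ^ N / real P - \<alpha> i) * real P ^ N \<in> \<int>"
      then have "of_int j - (of_int j / real P ^ N / real P - \<alpha> i) * real P ^ N * real P \<in> \<int>"
        by (intro Ints_diff Ints_mult[of _ "real P"]) auto
      then show False using False P by (simp add: algebra_simps)
    qed
    moreover have "of_int j / real P ^ N / real P - \<alpha> i \<in> Z_inv P"
      using Z_inv_diff[OF Z_inv_div_power[OF P, of "of_int j" "Suc N"] \<alpha>(1)[OF i]] by (simp add: mult.commute)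
    ultimately have "?l = 0" using supp by blast
    moreover have "?r = 0" using False by (intro sum.neutral) (metis Ints_of_nat)
    ultimately show ?thesis by simp
  qed
  \<comment> \<open>Generators with the same k agree on the grid, so their coefficients are added;
    the others contribute nothing.\<close>
  define c' where "c' k = (\<Sum>i<n. if \<alpha> i * (real P ^ N * real P) = real k then c i else 0)" for k :: nat
  have "(\<Sum>i<n. c i * \<Phi> (of_int j / real P ^ N / real P - \<alpha> i)) = (\<Sum>k<P * P ^ N. c' k * G (j - int k))" for j
  proof -
    have "(\<Sum>i<n. c i * \<Phi> (of_int j / real P ^ N / real P - \<alpha> i)) =
      (\<Sum>i<n. \<Sum>k<P * P ^ N. (if \<alpha> i * (real P ^ N * real P) = real k then c i else 0) * G (j - int k))"
    proof (rule sum.cong[OF refl])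
      fix i assume "i \<in> {..<n}"
      then have i: "i < n" by simp
      show "c i * \<Phi> (of_int j / real P ^ N / real P - \<alpha> i) =
        (\<Sum>k<P * P ^ N. (if \<alpha> i * (real P ^ N * real P) = real k then c i else 0) * G (j - int k))"
        unfolding single[OF i] sum_distrib_left by (intro sum.cong refl) auto
    qed
    also have "\<dots> = (\<Sum>k<P * P ^ N. c' k * G (j - int k))"
      by (subst sum.swap) (simp only: c'_def sum_distrib_right)
    finally show ?thesis .
  qed
  then show ?thesis unfolding G_def by blast
qed

lemma finite_common_denominator:
  assumes "\<And>i. i < (n::nat) \<Longrightarrow> \<alpha> i \<in> Z_inv P"
  obtains B where "\<And>i. i < n \<Longrightarrow> \<alpha> i * real P ^ B \<in> \<int>"
proof -
  obtain k where k: "\<And>i. i < n \<Longrightarrow> \<alpha> i * real P ^ k i \<in> \<int>"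
    using assms unfolding Z_inv_def mem_Collect_eq by metis
  show thesis
    by (rule that[of "Max (k ` {..<n})"]) (rule Z_inv_mono[OF k], auto)
qed

text \<open>Approximation in L^2 bounds the squared error summed over the grid points of one period.
  The span restricted to these finitely many points is closed, so the approximation becomes an
  identity.\<close>

lemma refinement_on_grid:
  fixes \<phi> :: "'p::finite qp \<Rightarrow> complex" and M N b :: nat
  defines "P \<equiv> CARD('p)"
  defines "\<Phi> \<equiv> \<lambda>r. \<phi> (qp_of_real r)"
  defines "g \<equiv> \<lambda>i::int. \<Phi> (of_int i / real P ^ N)"
  assumes per: "\<And>r. r \<in> Z_inv P \<Longrightarrow> \<Phi> (r + real P ^ M) = \<Phi> r"
    and supp: "\<And>r. r \<in> Z_inv P \<Longrightarrow> \<Phi> r \<noteq> 0 \<Longrightarrow> r * real P ^ N \<in> \<int>"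
    and closure: "in_L2_closure_span (\<lambda>x. \<phi> (x - qp_of_real (real b / real P ^ N)))
             {(\<lambda>x. \<phi> (qp_of_real (1 / real P) * x - a)) | a. a \<in> qp_I}"
  shows "\<exists>m. \<forall>i<P ^ (M + N) * P. g (int i - int b) =
    (\<Sum>k<P * P ^ N. m k * (if int P dvd int i - int k then g ((int i - int k) div int P) else 0))"
proof -
  have P: "P > 0" by (simp add: P_def)
  define w where "w k i = (if int P dvd int i - int k then g ((int i - int k) div int P) else 0)" for k i :: nat
  have per': "\<Phi> (r + real j * real P ^ M) = \<Phi> r" if "r \<in> Z_inv P" for r j
  proof (induction j)
    case (Suc j)
    have "r + real j * real P ^ M \<in> Z_inv P"
      by (intro Z_inv_add Z_inv_mult that Z_inv_Ints Ints_power) auto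
    from per[OF this] show ?case using Suc by (simp add: algebra_simps)
  qed simp
  have "\<exists>m. \<forall>i\<in>{..<P ^ (M + N) * P}. g (int i - int b) = (\<Sum>k<P * P ^ N. m k * w k i)"
  proof (rule finite_span_closed)
    fix \<epsilon> :: real assume "\<epsilon> > 0"
    \<comment> \<open>The divisor anticipates the normalising factor of the integral over a period
      P^(M+1).\<close>
    then have "\<epsilon> / real P ^ (M + 1) > 0" using P by simp
    then obtain h where h: "h \<in> cspan {(\<lambda>x. \<phi> (qp_of_real (1 / real P) * x - a)) | a. a \<in> qp_I}"
      and dist: "L2_dist2 (\<lambda>x. \<phi> (x - qp_of_real (real b / real P ^ N))) h < \<epsilon> / real P ^ (M + 1)"
      using closure unfolding in_L2_closure_span_def by blast
    obtain n :: nat and c f where f: "\<forall>i<n. f i \<in> {(\<lambda>x. \<phi> (qp_of_real (1 / real P) * x - a)) | a. a \<in> qp_I}"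
      and h_eq: "h = (\<lambda>x. \<Sum>i<n. c i * f i x)"
      using h unfolding cspan_def mem_Collect_eq[of h] by (elim exE conjE) (rule that)
    have "\<exists>\<alpha>. \<alpha> \<in> Z_inv P \<and> 0 \<le> \<alpha> \<and> \<alpha> < 1 \<and> f i = (\<lambda>x. \<phi> (qp_of_real (1 / real P) * x - qp_of_real \<alpha>))"
      if i: "i < n" for i
    proof -
      obtain a where "a \<in> qp_I" "f i = (\<lambda>x. \<phi> (qp_of_real (1 / real P) * x - a))" using f i by blast
      then show ?thesis unfolding P_def by (metis qp_I_cases)
    qed
    then obtain \<alpha> where \<alpha>: "\<And>i. i < n \<Longrightarrow> \<alpha> i \<in> Z_inv P" "\<And>i. i < n \<Longrightarrow> 0 \<le> \<alpha> i" "\<And>i. i < n \<Longrightarrow> \<alpha> i < 1"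
      and f_eq: "\<And>i. i < n \<Longrightarrow> f i = (\<lambda>x. \<phi> (qp_of_real (1 / real P) * x - qp_of_real (\<alpha> i)))"
      by metis
    define D where "D r = \<Phi> (r - real b / real P ^ N) - (\<Sum>i<n. c i * \<Phi> (r / real P - \<alpha> i))" for r
    have bZ: "real b / real P ^ N \<in> Z_inv P" by (rule Z_inv_div_power[OF P]) auto
    have div_Z: "r / real P \<in> Z_inv P" if "r \<in> Z_inv P" for r
      using Z_inv_mult[OF that Z_inv_div_power[OF P, of 1 1]] by simp
    have D: "\<phi> (qp_of_real r - qp_of_real (real b / real P ^ N)) - h (qp_of_real r) = D r" if r: "r \<in> Z_inv P" for r
    proof -
      have "f i (qp_of_real r) = \<Phi> (r / real P - \<alpha> i)" if "i < n" for i
        using qp_of_real_mult[where 'p = 'p, of "1 / real P" r] qp_of_real_diff[where 'p = 'p, of "r / real P" "\<alpha> i"]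
          r \<alpha>(1)[OF that] div_Z[OF r] Z_inv_div_power[OF P, of 1 1]
        by (simp add: f_eq[OF that] \<Phi>_def P_def)
      then show ?thesis
        using qp_of_real_diff[where 'p = 'p, OF r[unfolded P_def] bZ[unfolded P_def]]
        by (simp add: D_def h_eq \<Phi>_def P_def)
    qed
    obtain B0 where B0: "\<And>i. i < n \<Longrightarrow> \<alpha> i * real P ^ B0 \<in> \<int>"
      using finite_common_denominator \<alpha>(1) by blast
    \<comment> \<open>The shifts may have denominators beyond P^N, so the error D may be supported
      on a finer grid than the one of interest.\<close>
    define B where "B = max N B0"
    have "qp_integral (\<lambda>x. complex_of_real ((cmod (\<phi> (x - qp_of_real (real b / real P ^ N)) - h x))\<^sup>2))
        = (\<Sum>i<P ^ (M + 1 + B). complex_of_real ((cmod (D (real i / real P ^ B)))\<^sup>2)) / of_nat P ^ (M + 1)"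
      unfolding P_def
    proof (rule qp_integral_periodic; unfold P_def[symmetric])
      fix r assume r: "r \<in> Z_inv P"
      show "complex_of_real ((cmod (\<phi> (qp_of_real r - qp_of_real (real b / real P ^ N)) - h (qp_of_real r)))\<^sup>2)
          = complex_of_real ((cmod (D r))\<^sup>2)"
        by (simp only: D[OF r])
      \<comment> \<open>The dilation by 1/P turns the period P^M into P^(M+1), which is also a
        period of the translate.\<close>
      have "\<Phi> (r + real P ^ (M + 1) - real b / real P ^ N) = \<Phi> (r - real b / real P ^ N)"
        using per'[OF Z_inv_diff[OF r bZ], of P] by (simp add: algebra_simps)
      moreover have "\<Phi> ((r + real P ^ (M + 1)) / real P - \<alpha> i) = \<Phi> (r / real P - \<alpha> i)" if "i < n" for i
        using per[OF Z_inv_diff[OF div_Z[OF r] \<alpha>(1)[OF that]]] P by (simp add: algebra_simps add_divide_distrib)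
      ultimately have "D (r + real P ^ (M + 1)) = D r" by (simp add: D_def)
      then show "complex_of_real ((cmod (D (r + real P ^ (M + 1))))\<^sup>2) = complex_of_real ((cmod (D r))\<^sup>2)"
        by simp
      assume "complex_of_real ((cmod (D r))\<^sup>2) \<noteq> 0"
      then have "D r \<noteq> 0" by simp
      then consider "\<Phi> (r - real b / real P ^ N) \<noteq> 0" | i where "i < n" "\<Phi> (r / real P - \<alpha> i) \<noteq> 0"
        unfolding D_def by (metis (no_types, lifting) diff_zero lessThan_iff mult_zero_right sum.neutral)
      then show "r * real P ^ B \<in> \<int>"
      proof cases
        case 1
        then have "(r - real b / real P ^ N) * real P ^ N + real b \<in> \<int>"
          using supp[OF Z_inv_diff[OF r bZ]] by (intro Ints_add) auto
        then have "r * real P ^ N \<in> \<int>" using P by (simp add: algebra_simps)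
        then show ?thesis by (rule Z_inv_mono) (simp add: B_def)
      next
        case (2 i)
        have "(r / real P - \<alpha> i) * real P ^ B \<in> \<int>"
          using supp[OF Z_inv_diff[OF div_Z[OF r] \<alpha>(1)[OF 2(1)]] 2(2)]
          by (rule Z_inv_mono) (simp add: B_def)
        moreover have "\<alpha> i * real P ^ B \<in> \<int>"
          using B0[OF 2(1)] by (rule Z_inv_mono) (simp add: B_def)
        ultimately have "((r / real P - \<alpha> i) * real P ^ B + \<alpha> i * real P ^ B) * real P \<in> \<int>"
          by (intro Ints_mult[of _ "real P"] Ints_add) auto
        then show ?thesis using P by (simp add: algebra_simps)
      qed
    qed
    then have "L2_dist2 (\<lambda>x. \<phi> (x - qp_of_real (real b / real P ^ N))) h
        = Re (complex_of_real ((\<Sum>i<P ^ (M + 1 + B). (cmod (D (real i / real P ^ B)))\<^sup>2) / real P ^ (M + 1)))"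
      unfolding L2_dist2_def by simp
    then have "(\<Sum>i<P ^ (M + 1 + B). (cmod (D (real i / real P ^ B)))\<^sup>2) / real P ^ (M + 1) < \<epsilon> / real P ^ (M + 1)"
      using dist by (simp only: Re_complex_of_real)
    then have fine: "(\<Sum>i<P ^ (M + 1 + B). (cmod (D (real i / real P ^ B)))\<^sup>2) < \<epsilon>"
      using P by (simp only: divide_less_cancel) simp
    define Q where "Q = P ^ (B - N)"
    have Q: "Q > 0" "P ^ B = P ^ N * Q" "P ^ (M + 1 + B) = P ^ (M + N) * P * Q"
      using P by (auto simp: Q_def B_def power_add[symmetric] algebra_simps)
    have Q': "real P ^ B = real P ^ N * real Q"
      using Q(2) by (metis of_nat_mult of_nat_power)
    \<comment> \<open>The points j / P^N are the points j Q / P^B of the finer grid; the discarded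
      terms are nonnegative.\<close>
    have "(\<Sum>j<P ^ (M + N) * P. (cmod (D (real j / real P ^ N)))\<^sup>2)
        = (\<Sum>i\<in>(\<lambda>j. j * Q) ` {..<P ^ (M + N) * P}. (cmod (D (real i / real P ^ B)))\<^sup>2)"
      using Q(1) by (subst sum.reindex) (auto simp: inj_on_def Q')
    also have "\<dots> \<le> (\<Sum>i<P ^ (M + 1 + B). (cmod (D (real i / real P ^ B)))\<^sup>2)"
    proof (rule sum_mono2)
      show "(\<lambda>j. j * Q) ` {..<P ^ (M + N) * P} \<subseteq> {..<P ^ (M + 1 + B)}"
        unfolding Q(3) using Q(1) by auto
    qed auto
    finally have coarse: "(\<Sum>j<P ^ (M + N) * P. (cmod (D (real j / real P ^ N)))\<^sup>2) < \<epsilon>"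
      using fine by linarith
    obtain c' where c': "\<And>j. (\<Sum>i<n. c i * \<Phi> (of_int j / real P ^ N / real P - \<alpha> i)) =
      (\<Sum>k<P * P ^ N. c' k * (if int P dvd j - int k then g ((j - int k) div int P) else 0))"
      using cspan_translates_on_grid[where g = g and \<Phi> = \<Phi> and \<alpha> = \<alpha> and n = n and c = c, OF P _ supp \<alpha>]
      unfolding g_def by blast
    have "D (real j / real P ^ N) = g (int j - int b) - (\<Sum>k<P * P ^ N. c' k * w k j)" for j
      using c'[of "int j"] by (simp add: D_def g_def w_def diff_divide_distrib)
    then show "\<exists>c. (\<Sum>i<P ^ (M + N) * P. (cmod (g (int i - int b) - (\<Sum>k<P * P ^ N. c k * w k i)))\<^sup>2) < \<epsilon>"
      using coarse by auto
  qed simp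
  then show ?thesis unfolding w_def by blast
qed

theorem theorem4:
  fixes \<phi> :: "'p::finite qp \<Rightarrow> complex" and M N :: nat
  assumes "prime CARD('p)"
    and "\<phi> \<in> D_space N M"
    and "qp_fourier \<phi> 0 \<noteq> 0"
    and "\<forall>b\<in>qp_I. qp_norm b \<le> real CARD('p) ^ N \<longrightarrow>
           in_L2_closure_span (\<lambda>x. \<phi> (x - b))
             {(\<lambda>x. \<phi> (qp_of_real (1 / real CARD('p)) * x - a)) | a. a \<in> qp_I}"
  shows "card {l \<in> {0..<CARD('p) ^ (M + N)}.
           qp_fourier \<phi> (qp_of_real (real l / real CARD('p) ^ M)) \<noteq> 0} \<le> CARD('p) ^ N"
proof -
  define P where "P = CARD('p)"
  define \<Phi> where "\<Phi> r = \<phi> (qp_of_real r)" for r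
  define g where "g i = \<Phi> (of_int i / real P ^ N)" for i :: int
  have P1: "P > 1" using prime_gt_1_nat[OF assms(1)] by (simp add: P_def)
  then have P: "P > 0" by simp
  have per: "\<Phi> (r + real P ^ M) = \<Phi> r" if "r \<in> Z_inv P" for r
  proof -
    have "\<phi> (qp_of_real r + qp_of_real (real P ^ M)) = \<phi> (qp_of_real r)"
      using assms(2) by (auto simp: D_space_def P_def)
    then show ?thesis
      using qp_of_real_add[where 'p = 'p, of r "real P ^ M"] that
      by (simp add: \<Phi>_def P_def Z_inv_Ints)
  qed
  have supp: "r * real P ^ N \<in> \<int>" if r: "r \<in> Z_inv P" and "\<Phi> r \<noteq> 0" for r
  proof -
    have "qp_of_real r \<in> qp_ball (int N) (qp_of_real 0 :: 'p qp)"
      using assms(2) that(2) by (auto simp: D_space_def \<Phi>_def qp_of_real_0)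
    then have "qp_norm (qp_of_real r :: 'p qp) \<le> real P ^ N"
      using qp_of_real_diff[where 'p = 'p, of r 0] r by (simp add: qp_ball_def P_def Z_inv_Ints)
    then show ?thesis
      using qp_norm_qp_of_real_le_iff[where 'p = 'p, of r N] r P1 by (simp add: P_def)
  qed
  have fourier: "qp_fourier \<phi> (qp_of_real (real l / real P ^ M)) = dft (P ^ (M + N)) g (int l) / of_nat P ^ M" for l
  proof -
    let ?\<xi> = "real l / real P ^ M"
    let ?F = "\<lambda>r. cis (2 * pi * (?\<xi> * r)) * \<Phi> r"
    have \<xi>: "?\<xi> \<in> Z_inv P" by (rule Z_inv_div_power[OF P]) auto
    have "qp_fourier \<phi> (qp_of_real ?\<xi>) = (\<Sum>i<P ^ (M + N). ?F (real i / real P ^ N)) / of_nat P ^ M"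
      unfolding qp_fourier_def P_def
    proof (rule qp_integral_periodic; unfold P_def[symmetric])
      fix r assume r: "r \<in> Z_inv P"
      show "qp_chi (qp_of_real ?\<xi> * (qp_of_real r :: 'p qp)) * \<phi> (qp_of_real r) = ?F r"
        using qp_of_real_mult[where 'p = 'p, of ?\<xi> r] qp_chi_qp_of_real[where 'p = 'p, of "?\<xi> * r"]
          Z_inv_mult[OF \<xi> r] \<xi> r by (simp add: P_def \<Phi>_def)
      \<comment> \<open>A shift by P^M changes the phase by the integer l times 2 pi, so the
        integrand inherits the period of \<open>\<Phi>\<close>.\<close>
      have "2 * pi * (?\<xi> * (r + real P ^ M)) = 2 * pi * (?\<xi> * r) + 2 * pi * real l"
        using P by (simp add: field_simps)
      then have "cis (2 * pi * (?\<xi> * (r + real P ^ M))) = cis (2 * pi * (?\<xi> * r))"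
        using cis_mult[of "2 * pi * (?\<xi> * r)" "2 * pi * real l"] by simp
      then show "?F (r + real P ^ M) = ?F r" using per[OF r] by simp
      show "r * real P ^ N \<in> \<int>" if "?F r \<noteq> 0" using supp[OF r] that by auto
    qed
    also have "(\<Sum>i<P ^ (M + N). ?F (real i / real P ^ N)) = dft (P ^ (M + N)) g (int l)"
      unfolding dft_def sum_int_atLeastLessThan by (simp add: g_def power_add)
    finally show ?thesis .
  qed
  have "\<forall>b\<in>{..<P ^ N}. \<exists>m. \<forall>i<P ^ (M + N) * P. g (int i - int b) =
      (\<Sum>k<P * P ^ N. m k * (if int P dvd int i - int k then g ((int i - int k) div int P) else 0))"
    (is "\<forall>b\<in>_. \<exists>m. ?refines b m")
  proof
    fix b assume "b \<in> {..<P ^ N}"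
    then have b: "b < P ^ N" by simp
    \<comment> \<open>The points b / P^N with b < P^N lie in I_p and have norm at most p^N, so the
      closure hypothesis applies to each of these p^N shifts.\<close>
    have bZ: "real b / real P ^ N \<in> Z_inv CARD('p)"
      using Z_inv_div_power[OF P] by (simp add: P_def)
    have "real b < real P ^ N" using b by (metis of_nat_less_iff of_nat_power)
    then have "qp_of_real (real b / real P ^ N) \<in> (qp_I :: 'p qp set)"
      using qp_of_real_in_qp_I[OF bZ] P by simp
    moreover have "qp_norm (qp_of_real (real b / real P ^ N) :: 'p qp) \<le> real CARD('p) ^ N"
      using qp_norm_qp_of_real_le_iff[OF bZ] P1 by (simp add: P_def)
    ultimately show "\<exists>m. ?refines b m"
      using refinement_on_grid[of \<phi> M N b] per supp assms(4)
      by (simp add: P_def \<Phi>_def g_def cong: if_cong)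
  qed
  from bchoice[OF this] obtain m where "\<forall>b\<in>{..<P ^ N}. ?refines b (m b)" by blast
  moreover have "g (i + int (P ^ (M + N))) = g i" for i
    using per[of "of_int i / real P ^ N"] Z_inv_div_power[OF P, of "of_int i" N] P
    by (simp add: g_def add_divide_distrib power_add)
  ultimately have "card {l \<in> {..<P ^ (M + N)}. dft (P ^ (M + N)) g (int l) \<noteq> 0} \<le> P ^ N"
    using card_dft_support_le[of "P ^ (M + N)" P "P ^ N" g m] P1 by simp
  then show ?thesis
    unfolding P_def[symmetric] using P by (simp add: fourier lessThan_atLeast0)
qed

end
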